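(* If $X$ and $Y$ are Tychonoff spaces and $T:D_p(X)\to D_p(Y)$ is a surjective continuous linear map such that $\dim X=0$, then $\dim Y=0$.
   Context: For a Tychonoff space $X$, $C(X)$ is the linear space of all continuous real-valued functions on $X$ and $C^*(X)$ is its subspace of bounded functions. $D(X)$ denotes either $C(X)$ or $C^*(X)$, and $D(Y)$ denotes either $C(Y)$ or $C^*(Y)$; the two choices are independent (so there are four possible cases, and the result is asserted in each of them). $D_p(X)$ is $D(X)$ endowed with the topology of pointwise convergence. $\dim$ is the covering dimension: for a Tychonoff space $X$ and an integer $n\ge 0$, $\dim X\leq n$ if every finite functionally open (cozero) cover of $X$ has a finite functionally open refinement of order $\leq n$ (every point lies in at most $n+1$ members). *)

theory Defs
  imports "HOL-Analysis.Analysis"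
begin

definition tychonoff_space :: "'a topology \<Rightarrow> bool" where
  "tychonoff_space X \<longleftrightarrow> completely_regular_space X \<and> Hausdorff_space X"

text \<open>A real function on the space \<open>X\<close> is represented by its extensional representative on
  \<open>topspace X\<close>, i.e. by a point of the power \<open>product_topology (\<lambda>_. euclideanreal) (topspace X)\<close>,
  so that equality in HOL is equality of functions on \<open>X\<close>.\<close>

definition C_fun :: "'a topology \<Rightarrow> ('a \<Rightarrow> real) set" where
  "C_fun X = {f \<in> extensional (topspace X). continuous_map X euclideanreal f}"

definition C_bounded_fun :: "'a topology \<Rightarrow> ('a \<Rightarrow> real) set" where
  "C_bounded_fun X = {f \<in> C_fun X. bounded (f ` topspace X)}"

text \<open>The topology of pointwise convergence on a set \<open>D\<close> of real functions on \<open>X\<close>.\<close>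

definition pointwise_topology :: "'a topology \<Rightarrow> ('a \<Rightarrow> real) set \<Rightarrow> ('a \<Rightarrow> real) topology" where
  "pointwise_topology X D =
     subtopology (product_topology (\<lambda>_. euclideanreal) (topspace X)) D"

definition linear_on_fun_space ::
  "'a topology \<Rightarrow> 'b topology \<Rightarrow> ('a \<Rightarrow> real) set \<Rightarrow> (('a \<Rightarrow> real) \<Rightarrow> ('b \<Rightarrow> real)) \<Rightarrow> bool" where
  "linear_on_fun_space X Y D T \<longleftrightarrow>
     (\<forall>f\<in>D. \<forall>g\<in>D. T (\<lambda>x\<in>topspace X. f x + g x) = (\<lambda>y\<in>topspace Y. T f y + T g y)) \<and>
     (\<forall>c. \<forall>f\<in>D. T (\<lambda>x\<in>topspace X. c * f x) = (\<lambda>y\<in>topspace Y. c * T f y))"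

definition functionally_open :: "'a topology \<Rightarrow> 'a set \<Rightarrow> bool" where
  "functionally_open X U \<longleftrightarrow>
     (\<exists>f. continuous_map X euclideanreal f \<and> U = {x \<in> topspace X. f x \<noteq> 0})"

definition finite_functionally_open_cover :: "'a topology \<Rightarrow> 'a set set \<Rightarrow> bool" where
  "finite_functionally_open_cover X \<U> \<longleftrightarrow>
     finite \<U> \<and> (\<forall>U\<in>\<U>. functionally_open X U) \<and> \<Union>\<U> = topspace X"

definition cover_refines :: "'a set set \<Rightarrow> 'a set set \<Rightarrow> bool" where
  "cover_refines \<V> \<U> \<longleftrightarrow> (\<forall>V\<in>\<V>. \<exists>U\<in>\<U>. V \<subseteq> U)"

definition covering_dim_le :: "'a topology \<Rightarrow> nat \<Rightarrow> bool" where
  "covering_dim_le X n \<longleftrightarrow>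
     (\<forall>\<U>. finite_functionally_open_cover X \<U> \<longrightarrow>
        (\<exists>\<V>. finite_functionally_open_cover X \<V> \<and> cover_refines \<V> \<U> \<and>
             (\<forall>x\<in>topspace X. card {V \<in> \<V>. x \<in> V} \<le> n + 1)))"

text \<open>The least \<open>n \<ge> 0\<close> with \<open>covering_dim_le X n\<close>, and \<open>\<infinity>\<close> if there is none. Only \<open>n \<ge> 0\<close>
  is considered, so the empty space has dimension \<open>0\<close> (not \<open>-1\<close>).\<close>

definition covering_dim :: "'a topology \<Rightarrow> enat" where
  "covering_dim X = Inf {enat n | n. covering_dim_le X n}"

end

theory Submission
  imports Defs "HOL-Library.Function_Algebras"
begin

text \<open>Fix a continuous \<open>h\<close> from \<open>Y\<close> to the unit interval; it suffices to separate its level sets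
  0 and 1 by a clopen set. Closing off \<open>h\<close> under products, preimages under \<open>T\<close> and indicators of
  clopen sets near level sets gives a countable family \<open>val t\<close> in \<open>D(X)\<close> that maps \<open>X\<close> onto a
  zero-dimensional set \<open>X'\<close> in the metrizable space of real functions of the index \<open>t\<close>, such that
  the functions \<open>T (val t)\<close> form a multiplicative system on \<open>Y\<close> containing \<open>h\<close> and 1. As each
  functional \<open>f \<mapsto> T f y\<close> is a finite combination of point evaluations, \<open>Y\<close> maps into the set \<open>Z\<close>
  of all functions in the linear span of \<open>X'\<close> that are multiplicative with respect to the product
  of \<open>Y\<close>.

  \<open>Z\<close> is zero-dimensional. It is a countable union of closed pieces on which the points of the
  support are separated by indices \<open>v \<in> V\<close> and the coefficients \<open>p v\<close> are bounded and bounded away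
  from 0. Sending \<open>p\<close> to its support is a perfect map from a piece to a power of \<open>X'\<close>: limits of the
  coefficients exist, and the limit functional is again multiplicative, hence in \<open>Z\<close>. (This is why
  \<open>Z\<close> is used instead of the image of \<open>Y\<close>.) Its fibres are finite, as distinct multiplicative
  functions are linearly independent (Dedekind). So the pieces are zero-dimensional, and so is \<open>Z\<close>
  by the countable sum theorem.\<close>

subsection \<open>Multiplicative functionals\<close>

interpretation fun_space: vector_space "\<lambda>(r::real) (p :: 'i \<Rightarrow> real) i. r * p i"
  by unfold_locales (auto simp: fun_eq_iff algebra_simps)

lemma sum_fun_apply: "(\<Sum>a\<in>A. f a) i = (\<Sum>a\<in>A. f a i)"
  for f :: "'a \<Rightarrow> 'i \<Rightarrow> 'b::comm_monoid_add"
  by (induction A rule: infinite_finite_induct) auto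

text \<open>The operation \<open>m\<close> is left arbitrary because it will be a constructor of
  formal products, which obeys no algebraic laws.\<close>

definition character :: "('i \<Rightarrow> 'i \<Rightarrow> 'i) \<Rightarrow> ('i \<Rightarrow> real) \<Rightarrow> bool" where
  "character m p \<longleftrightarrow> (\<forall>a b. p (m a b) = p a * p b) \<and> (\<exists>a. p a \<noteq> 0)"

text \<open>Dedekind's argument. Subtracting \<open>q a\<close> times the relation at
  \<open>b\<close> from the relation at \<open>m a b\<close> cancels the term of \<open>q\<close>
  and leaves a relation on the smaller set, with coefficients \<open>c p' * (p' a - q a)\<close>.
  These vanish by induction, and for each \<open>p'\<close> some \<open>a\<close> has
  \<open>p' a \<noteq> q a\<close>.\<close>

lemma characters_sum_eq_0:
  assumes "finite S" "\<And>p. p \<in> S \<Longrightarrow> character m p" "\<And>i. (\<Sum>p\<in>S. c p * p i) = 0" "p \<in> S"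
  shows "c p = 0"
  using assms
proof (induction S arbitrary: c p rule: finite_induct)
  case empty
  then show ?case by simp
next
  case (insert q S)
  have q: "q (m a b) = q a * q b" for a b
    using insert.prems(1)[of q] by (auto simp: character_def)
  have S: "p' (m a b) = p' a * p' b" if "p' \<in> S" for a b p'
    using insert.prems(1)[of p'] that by (auto simp: character_def)
  have "(\<Sum>p'\<in>S. c p' * (p' a - q a) * p' b) = 0" for a b
  proof -
    have "(\<Sum>p'\<in>insert q S. c p' * p' (m a b)) - q a * (\<Sum>p'\<in>insert q S. c p' * p' b) = 0"
      using insert.prems(2) by simp
    moreover have "(\<Sum>p'\<in>S. c p' * p' (m a b)) = (\<Sum>p'\<in>S. c p' * p' a * p' b)"
      using S by (intro sum.cong) auto
    ultimately show ?thesis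
      using insert.hyps q
      by (simp add: algebra_simps sum_subtractf sum_distrib_left)
  qed
  then have *: "c p' * (p' a - q a) = 0" if "p' \<in> S" for a p'
    using insert.IH[of "\<lambda>p'. c p' * (p' a - q a)" p'] insert.prems(1) that by auto
  have cS: "c p' = 0" if p': "p' \<in> S" for p'
  proof -
    have "p' \<noteq> q" using p' insert.hyps by auto
    then obtain a where "p' a \<noteq> q a" by (auto simp: fun_eq_iff)
    then show ?thesis using *[OF p', of a] by simp
  qed
  obtain a where "q a \<noteq> 0" using insert.prems(1)[of q] by (auto simp: character_def)
  moreover have "c q * q a = 0"
    using insert.prems(2)[of a] insert.hyps cS by simp
  ultimately have "c q = 0" by simp
  then show ?case using cS insert.prems(3) by auto
qed

lemma characters_independent:
  assumes "\<And>p. p \<in> M \<Longrightarrow> character m p"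
  shows "fun_space.independent M"
  unfolding fun_space.independent_explicit_module
proof (intro allI impI)
  fix S u v
  assume *: "finite S" "S \<subseteq> M" "(\<Sum>v\<in>S. (\<lambda>i. u v * v i)) = 0" "v \<in> S"
  have "(\<Sum>p\<in>S. u p * p i) = 0" for i
    using fun_cong[OF *(3), of i] by (simp add: sum_fun_apply)
  then show "u v = 0"
    using characters_sum_eq_0[of S m u v] * assms by blast
qed

text \<open>For \<open>q\<close> outside \<open>M\<close>, independence of \<open>insert q M\<close>
  would keep \<open>q\<close> out of the span.\<close>

lemma character_in_span:
  assumes "\<And>p. p \<in> M \<Longrightarrow> character m p" "character m q" "q \<in> fun_space.span M"
  shows "q \<in> M"
proof -
  have "fun_space.independent (insert q M)"
    by (rule characters_independent[of _ m]) (use assms in auto)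
  then show ?thesis
    using assms(3) by (auto simp: fun_space.independent_insert split: if_splits)
qed

text \<open>The characters in the span form an independent set, so there are at most
  \<open>card F\<close> of them. This is the source of the finite fibres.\<close>

lemma finite_characters_in_span:
  assumes "finite F"
  shows "finite {p \<in> fun_space.span F. character m p}"
proof -
  have "fun_space.independent {p \<in> fun_space.span F. character m p}"
    by (rule characters_independent[of _ m]) auto
  then show ?thesis
    using fun_space.independent_span_bound[OF assms] by auto
qed

subsection \<open>The countable sum theorem\<close>

text \<open>Split \<open>K\<close> into \<open>P\<close> and \<open>Q\<close> compatibly with
  \<open>A\<close> and \<open>B\<close>. Then \<open>A \<union> P\<close> and
  \<open>B \<union> Q\<close> are disjoint closed sets, and normality thickens them to open sets
  with disjoint closures; these closures are \<open>A'\<close> and \<open>B'\<close>.\<close>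

lemma normal_space_split_step:
  assumes "normal_space Z" "closedin Z A" "closedin Z B" "disjnt A B" "closedin Z K"
    and K: "\<And>E F. closedin Z E \<Longrightarrow> closedin Z F \<Longrightarrow> disjnt E F \<Longrightarrow>
          \<exists>P Q. closedin Z P \<and> closedin Z Q \<and> disjnt P Q \<and> P \<union> Q = K \<and> disjnt E Q \<and> disjnt F P"
  shows "\<exists>A' B'. closedin Z A' \<and> closedin Z B' \<and> disjnt A' B'
          \<and> A \<subseteq> Z interior_of A' \<and> B \<subseteq> Z interior_of B' \<and> K \<subseteq> A' \<union> B'"
proof -
  obtain P Q where PQ: "closedin Z P" "closedin Z Q" "disjnt P Q" "P \<union> Q = K" "disjnt A Q" "disjnt B P"
    using K assms(2-4) by blast
  have "closedin Z (A \<union> P)" "closedin Z (B \<union> Q)" "disjnt (A \<union> P) (B \<union> Q)"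
    using PQ assms by (auto simp: disjnt_def)
  then obtain U V where UV: "openin Z U" "openin Z V" "A \<union> P \<subseteq> U" "B \<union> Q \<subseteq> V"
      "disjnt (Z closure_of U) (Z closure_of V)"
    using assms(1) unfolding normal_space_disjoint_closures by meson
  have cl: "U \<subseteq> Z closure_of U" "V \<subseteq> Z closure_of V"
    using UV(1,2) by (simp_all add: closure_of_subset openin_subset)
  then have int: "U \<subseteq> Z interior_of (Z closure_of U)" "V \<subseteq> Z interior_of (Z closure_of V)"
    using UV(1,2) by (simp_all add: interior_of_maximal)
  have "A \<subseteq> Z interior_of (Z closure_of U)" "B \<subseteq> Z interior_of (Z closure_of V)"
    using UV(3,4) int by blast+
  moreover have "K \<subseteq> Z closure_of U \<union> Z closure_of V"
    using UV(3,4) PQ(4) cl by blast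
  ultimately show ?thesis
    using UV(5) closedin_closure_of by metis
qed

lemma openin_UN_interior:
  fixes A :: "nat \<Rightarrow> 'a set"
  assumes "\<And>n. A n \<subseteq> Z interior_of A (Suc n)"
  shows "openin Z (\<Union>n. A n)"
proof (subst openin_subopen, rule ballI)
  fix x assume "x \<in> (\<Union>n. A n)"
  then obtain n where "x \<in> A n" by blast
  then have "x \<in> Z interior_of A (Suc n)" using assms by blast
  moreover have "Z interior_of A (Suc n) \<subseteq> (\<Union>n. A n)" using interior_of_subset by fast
  ultimately show "\<exists>T. openin Z T \<and> x \<in> T \<and> T \<subseteq> (\<Union>n. A n)"
    by (intro exI[of _ "Z interior_of A (Suc n)"]) simp
qed

text \<open>Iterating the splitting step gives increasing closed sets \<open>A n\<close> and
  \<open>B n\<close> around \<open>E\<close> and \<open>F\<close>, each in the interior of its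
  successor, with \<open>K n\<close> absorbed at stage \<open>n\<close>. Their unions are open by
  the interior condition, disjoint by monotonicity, and cover the space, hence are clopen.\<close>

lemma normal_space_clopen_separation:
  fixes K :: "nat \<Rightarrow> 'a set"
  assumes Z: "normal_space Z" and E: "closedin Z E" and F: "closedin Z F" and EF: "disjnt E F"
    and Kc: "\<And>n. closedin Z (K n)" and Kcov: "topspace Z \<subseteq> (\<Union>n. K n)"
    and K: "\<And>n E F. closedin Z E \<Longrightarrow> closedin Z F \<Longrightarrow> disjnt E F \<Longrightarrow>
          \<exists>P Q. closedin Z P \<and> closedin Z Q \<and> disjnt P Q \<and> P \<union> Q = K n \<and> disjnt E Q \<and> disjnt F P"
  obtains C where "openin Z C" "closedin Z C" "E \<subseteq> C" "disjnt F C"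
proof -
  define inv where "inv = (\<lambda>S. closedin Z (fst S) \<and> closedin Z (snd S) \<and> disjnt (fst S) (snd S)
      \<and> E \<subseteq> fst S \<and> F \<subseteq> snd S)"
  define rel where "rel = (\<lambda>n S S'. fst S \<subseteq> Z interior_of fst S' \<and> snd S \<subseteq> Z interior_of snd S'
      \<and> K n \<subseteq> fst S' \<union> snd S')"
  have "\<exists>S. \<forall>n. inv (S n) \<and> rel n (S n) (S (Suc n))"
  proof (rule dependent_nat_choice)
    show "\<exists>S. inv S"
      by (rule exI[of _ "(E, F)"]) (use E F EF in \<open>auto simp: inv_def\<close>)
  next
    fix S n
    assume "inv S"
    then have S: "closedin Z (fst S)" "closedin Z (snd S)" "disjnt (fst S) (snd S)" "E \<subseteq> fst S" "F \<subseteq> snd S"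
      by (auto simp: inv_def)
    have "\<exists>A' B'. closedin Z A' \<and> closedin Z B' \<and> disjnt A' B'
          \<and> fst S \<subseteq> Z interior_of A' \<and> snd S \<subseteq> Z interior_of B' \<and> K n \<subseteq> A' \<union> B'"
      by (rule normal_space_split_step[OF Z S(1-3) Kc]) (rule K)
    then obtain A' B' where *: "closedin Z A'" "closedin Z B'" "disjnt A' B'"
      "fst S \<subseteq> Z interior_of A'" "snd S \<subseteq> Z interior_of B'" "K n \<subseteq> A' \<union> B'"
      by blast
    then have "inv (A', B') \<and> rel n S (A', B')"
      using S interior_of_subset[of Z A'] interior_of_subset[of Z B'] unfolding inv_def rel_def by auto
    then show "\<exists>S'. inv S' \<and> rel n S S'" by blast
  qed
  then obtain S where S: "\<And>n. inv (S n)" "\<And>n. rel n (S n) (S (Suc n))" by blast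
  define A B where "A n = fst (S n)" and "B n = snd (S n)" for n
  have step: "A n \<subseteq> Z interior_of A (Suc n)" "B n \<subseteq> Z interior_of B (Suc n)" "K n \<subseteq> A (Suc n) \<union> B (Suc n)" for n
    using S(2)[of n] unfolding rel_def A_def B_def by auto
  have inv: "A n \<inter> B n = {}" "E \<subseteq> A n" "F \<subseteq> B n" for n
    using S(1)[of n] unfolding inv_def A_def B_def by (auto simp: disjnt_def)
  have Suc: "A n \<subseteq> A (Suc n)" "B n \<subseteq> B (Suc n)" for n
    using step[of n] interior_of_subset[of Z "A (Suc n)"] interior_of_subset[of Z "B (Suc n)"] by auto
  have mono: "A m \<subseteq> A n" "B m \<subseteq> B n" if "m \<le> n" for m n
    using lift_Suc_mono_le[of A, OF Suc(1) that] lift_Suc_mono_le[of B, OF Suc(2) that] .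
  have disj: "A m \<inter> B n = {}" for m n
    using mono(1)[of m "max m n"] mono(2)[of n "max m n"] inv(1)[of "max m n"] by auto
  define SA SB where "SA = (\<Union>n. A n)" and "SB = (\<Union>n. B n)"
  have sub: "A n \<subseteq> SA" "B n \<subseteq> SB" for n
    by (auto simp: SA_def SB_def)
  have "openin Z SA" "openin Z SB"
    unfolding SA_def SB_def by (rule openin_UN_interior, rule step)+
  have "SA \<inter> SB = {}"
    using disj by (auto simp: SA_def SB_def)
  then have "F \<inter> SA = {}" using inv(3)[of 0] sub(2)[of 0] by blast
  have "topspace Z \<subseteq> SA \<union> SB"
  proof
    fix x assume "x \<in> topspace Z"
    then obtain n where "x \<in> K n" using Kcov by auto
    then show "x \<in> SA \<union> SB" using step(3)[of n] sub[of "Suc n"] by blast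
  qed
  then have "topspace Z - SA = SB"
    using \<open>SA \<inter> SB = {}\<close> openin_subset[OF \<open>openin Z SB\<close>] by blast
  then have "closedin Z SA"
    using \<open>openin Z SA\<close> \<open>openin Z SB\<close> openin_subset[of Z SA] by (simp add: closedin_def)
  moreover have "E \<subseteq> SA" using inv(2)[of 0] sub(1)[of 0] by blast
  ultimately show ?thesis
    using that[of SA] \<open>openin Z SA\<close> \<open>F \<inter> SA = {}\<close> by (simp add: disjnt_def)
qed

text \<open>Each point is assigned by the first \<open>n\<close> for which
  \<open>P n \<union> Q n\<close> contains it, to \<open>A\<close> or \<open>B\<close> according to
  the half it lies in. The sets \<open>R n\<close> of earlier points are finite unions of closed
  sets, so \<open>A\<close> and \<open>B\<close> are open, and being complementary they are also
  closed.\<close>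

lemma clopen_split_countable:
  fixes P Q :: "nat \<Rightarrow> 'a set"
  assumes P: "\<And>n. openin K (P n)" and Q: "\<And>n. openin K (Q n)" and PQ: "\<And>n. P n \<inter> Q n = {}"
    and cl: "\<And>n. closedin K (P n \<union> Q n)" and cov: "topspace K \<subseteq> (\<Union>n. P n \<union> Q n)"
    and E: "\<And>n. disjnt E (Q n)" and F: "\<And>n. disjnt F (P n)"
  shows "\<exists>A B. closedin K A \<and> closedin K B \<and> disjnt A B \<and> A \<union> B = topspace K \<and> disjnt E B \<and> disjnt F A"
proof -
  define R where "R n = (\<Union>j<n. P j \<union> Q j)" for n
  define A where "A = (\<Union>n. P n - R n)"
  define B where "B = (\<Union>n. Q n - R n)"
  have R: "closedin K (R n)" for n unfolding R_def by (rule closedin_Union) (use cl in auto)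
  have AB_open: "openin K A" "openin K B"
    unfolding A_def B_def using P Q R by (auto intro!: openin_Union openin_diff)
  have AB_disj: "A \<inter> B = {}"
  proof -
    have False if "x \<in> P m" "x \<notin> R m" "x \<in> Q n" "x \<notin> R n" for x m n
      using that PQ[of m] by (cases m n rule: linorder_cases) (auto simp: R_def)
    then show ?thesis unfolding A_def B_def by blast
  qed
  have AB_cov: "A \<union> B = topspace K"
  proof
    show "A \<union> B \<subseteq> topspace K" using AB_open openin_subset by blast
    show "topspace K \<subseteq> A \<union> B"
    proof
      fix x assume "x \<in> topspace K"
      then have ex: "\<exists>n. x \<in> P n \<union> Q n" using cov by auto
      define n where "n = (LEAST n. x \<in> P n \<union> Q n)"
      have "x \<in> P n \<union> Q n" unfolding n_def by (rule LeastI_ex[OF ex])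
      moreover have "x \<notin> R n" using not_less_Least unfolding R_def n_def by blast
      ultimately show "x \<in> A \<union> B" unfolding A_def B_def by auto
    qed
  qed
  have "closedin K A" "closedin K B"
    using AB_open AB_disj AB_cov by (metis Diff_cancel Diff_triv Un_Diff closedin_def inf_commute
      openin_subset sup_bot_left sup_bot_right)+
  moreover have "disjnt E B" "disjnt F A"
    using E F by (auto simp: A_def B_def disjnt_def)
  ultimately show ?thesis using AB_disj AB_cov by (auto simp: disjnt_def)
qed

subsection \<open>Multiplicative functions in the span of a zero-dimensional set\<close>

lemma tendsto_fun_iff:
  fixes f :: "'a \<Rightarrow> 'i \<Rightarrow> 'b::topological_space"
  shows "(f \<longlongrightarrow> l) F \<longleftrightarrow> (\<forall>i. ((\<lambda>n. f n i) \<longlongrightarrow> l i) F)"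
  using limitin_componentwise[of "\<lambda>_. euclidean" UNIV f l F]
  by (simp add: euclidean_product_topology)

text \<open>A cube is compact by Tychonoff's theorem, and sequentially so because a countable power
  of the reals is metrizable.\<close>

lemma bounded_pointwise_subsequence:
  fixes p :: "nat \<Rightarrow> 'i::countable \<Rightarrow> real"
  assumes "\<And>n v. v \<in> V \<Longrightarrow> \<bar>p n v\<bar> \<le> M"
  obtains r l where "strict_mono r" "\<And>v. v \<in> V \<Longrightarrow> (\<lambda>n. p (r n) v) \<longlonglongrightarrow> l v"
proof -
  \<comment> \<open>The absolute value keeps the cube nonempty when \<open>V\<close> is empty and
    \<open>M\<close> is negative.\<close>
  let ?S = "PiE (UNIV::'i set) (\<lambda>_. {-\<bar>M\<bar>..\<bar>M\<bar>})"
  \<comment> \<open>No bound is known outside \<open>V\<close>, so those coordinates are set to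
    0.\<close>
  define g where "g n = (\<lambda>v. if v \<in> V then p n v else 0)" for n
  have "compact ?S"
    using compactin_PiE[of "\<lambda>_::'i. euclideanreal" UNIV "\<lambda>_. {-\<bar>M\<bar>..\<bar>M\<bar>}"]
    by (simp add: euclidean_product_topology)
  moreover have "\<forall>n. g n \<in> ?S"
  proof
    fix n
    have "- \<bar>M\<bar> \<le> p n v" "p n v \<le> \<bar>M\<bar>" if "v \<in> V" for v
      using assms[OF that, of n] by linarith+
    then show "g n \<in> ?S" by (auto simp: g_def)
  qed
  ultimately obtain l r where "strict_mono r" "(g \<circ> r) \<longlonglongrightarrow> l"
    by (metis compact_def)
  then have *: "(\<lambda>n. g (r n) v) \<longlonglongrightarrow> l v" for v
    by (simp add: tendsto_fun_iff o_def)
  have "(\<lambda>n. p (r n) v) \<longlonglongrightarrow> l v" if "v \<in> V" for v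
    using *[of v] that by (simp add: g_def)
  then show ?thesis
    using that \<open>strict_mono r\<close> by blast
qed

text \<open>A point of \<open>X\<close> is given by its values at countably many indices, and
  \<open>xm\<close> produces the index of a product. \<open>X_local\<close> expresses
  zero-dimensionality: the indicator of a clopen set between a level set and a neighbourhood of it
  is again one of the coordinates.\<close>

locale character_pair =
  fixes X :: "('i::countable \<Rightarrow> real) set" and xm ym :: "'i \<Rightarrow> 'i \<Rightarrow> 'i" and one :: 'i
  assumes X_mult: "x \<in> X \<Longrightarrow> x (xm a b) = x a * x b"
    and X_local: "0 < e \<Longrightarrow> \<exists>c. (\<forall>x\<in>X. x c = 0 \<or> x c = 1) \<and> (\<forall>x\<in>X. x t = r \<longrightarrow> x c = 1)
                              \<and> (\<forall>x\<in>X. x c = 1 \<longrightarrow> \<bar>x t - r\<bar> < e)"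
begin

definition Z :: "('i \<Rightarrow> real) set" where
  "Z = {p \<in> fun_space.span X. p one = 1 \<and> (\<forall>a b. p (ym a b) = p a * p b)}"

definition clopen_index :: "'i \<Rightarrow> bool" where
  "clopen_index c \<longleftrightarrow> (\<forall>x\<in>X. x c = 0 \<or> x c = 1)"

text \<open>If \<open>p\<close> is a linear combination of points of \<open>X\<close> and \<open>v\<close> is 1 at one of them and 0 at the
  others, then \<open>cmpt p v\<close> is that point and \<open>p v\<close> its coefficient.\<close>

definition cmpt :: "('i \<Rightarrow> real) \<Rightarrow> 'i \<Rightarrow> 'i \<Rightarrow> real" where
  "cmpt p v t = p (xm v t) / p v"

text \<open>The equation with triple products says that \<open>cmpt p v\<close> is multiplicative, hence lies in \<open>X\<close>
  by independence. In this form all conditions are closed.\<close>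

definition piece_conds :: "'i set \<Rightarrow> nat \<Rightarrow> ('i \<Rightarrow> real) set" where
  "piece_conds V m = {p. (\<forall>v. v \<in> V \<longrightarrow> 1 / (real m + 1) \<le> \<bar>p v\<bar> \<and> \<bar>p v\<bar> \<le> real m + 1 \<and> p (xm v v) = p v \<and>
       (\<forall>a b. p v * p (xm v (xm a b)) = p (xm v a) * p (xm v b))) \<and>
     (\<forall>t. p t = (\<Sum>v\<in>V. p (xm v t)))}"

definition piece :: "'i set \<Rightarrow> nat \<Rightarrow> ('i \<Rightarrow> real) set" where
  "piece V m = Z \<inter> piece_conds V m"

lemma X_unit_index: "x \<in> X \<Longrightarrow> \<exists>c. x c = 1"
  using X_local[where e = 1 and t = undefined and r = "x undefined"] by auto

lemma X_character: "x \<in> X \<Longrightarrow> character xm x"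
  using X_unit_index[of x] X_mult[of x] unfolding character_def by (metis zero_neq_one)

lemma Z_character: "p \<in> Z \<Longrightarrow> character ym p"
  unfolding Z_def character_def by (auto intro!: exI[of _ one])

lemma X_separating:
  assumes "x \<in> X" "x' \<in> X" "x \<noteq> x'"
  obtains c where "x c = 1" "x' c = 0"
proof -
  obtain t where t: "x t \<noteq> x' t" using assms by auto
  then obtain c where c: "\<forall>x\<in>X. x c = 0 \<or> x c = 1" "\<forall>y\<in>X. y t = x t \<longrightarrow> y c = 1"
      "\<forall>y\<in>X. y c = 1 \<longrightarrow> \<bar>y t - x t\<bar> < \<bar>x' t - x t\<bar>"
    using X_local[where e = "\<bar>x' t - x t\<bar>" and r = "x t" and t = t] by auto
  have "x c = 1" using c(2) assms(1) by simp
  moreover have "x' c \<noteq> 1" using c(3) assms(2) by blast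
  ultimately show ?thesis using that c(1) assms(2) by blast
qed

text \<open>The product under \<open>xm\<close> of indices that separate \<open>z\<close> from the
  single points of \<open>F\<close>.\<close>

lemma X_separating_finite:
  assumes "finite F" "F \<subseteq> X" "z \<in> X" "z \<notin> F"
  shows "\<exists>v. z v = 1 \<and> (\<forall>x\<in>F. x v = 0)"
  using assms
proof (induction F rule: finite_induct)
  case empty
  then show ?case using X_unit_index by simp
next
  case (insert x F)
  then obtain v where v: "z v = 1" "\<forall>x\<in>F. x v = 0" by auto
  obtain c where c: "z c = 1" "x c = 0" using X_separating[of z x] insert.prems by auto
  have "z (xm v c) = 1" using v c X_mult[of z v c] insert.prems by simp
  moreover have "y (xm v c) = 0" if "y \<in> insert x F" for y
    using that v c X_mult[of y v c] insert.prems by auto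
  ultimately show ?case by blast
qed

lemma closed_piece_conds: "closed (piece_conds V m)"
  unfolding piece_conds_def
  by (intro closed_Collect_conj closed_Collect_all closed_Collect_imp closed_Collect_eq closed_Collect_le open_Collect_const continuous_intros
      continuous_on_product_coordinates)

lemma closedin_piece: "closedin (top_of_set Z) (piece V m)"
  unfolding piece_def using closed_piece_conds closedin_closed by blast

text \<open>The shift by \<open>v\<close> is linear in \<open>p\<close> and multiplies each
  \<open>x \<in> X\<close> by the scalar \<open>x v\<close>, so it preserves the span.\<close>

lemma span_shift:
  assumes "p \<in> fun_space.span X"
  shows "(\<lambda>t. p (xm v t)) \<in> fun_space.span X"
proof -
  have "fun_space.subspace {p. (\<lambda>t. p (xm v t)) \<in> fun_space.span X}"
  proof (rule fun_space.subspaceI)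
    show "0 \<in> {p. (\<lambda>t. p (xm v t)) \<in> fun_space.span X}"
      using fun_space.span_zero[of X] by (simp add: zero_fun_def)
  next
    fix p q assume "p \<in> {p. (\<lambda>t. p (xm v t)) \<in> fun_space.span X}" "q \<in> {p. (\<lambda>t. p (xm v t)) \<in> fun_space.span X}"
    then show "p + q \<in> {p. (\<lambda>t. p (xm v t)) \<in> fun_space.span X}"
      using fun_space.span_add[of "\<lambda>t. p (xm v t)" X "\<lambda>t. q (xm v t)"] by (simp add: plus_fun_def)
  next
    fix c p assume "p \<in> {p. (\<lambda>t. p (xm v t)) \<in> fun_space.span X}"
    then show "(\<lambda>i. c * p i) \<in> {p. (\<lambda>t. p (xm v t)) \<in> fun_space.span X}"
      using fun_space.span_scale[of "\<lambda>t. p (xm v t)" X c] by simp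
  qed
  moreover have "X \<subseteq> {p. (\<lambda>t. p (xm v t)) \<in> fun_space.span X}"
    using fun_space.span_scale[OF fun_space.span_base, of _ X] by (auto simp: X_mult)
  ultimately show ?thesis using fun_space.span_minimal assms by blast
qed

section \<open>Components of the points of a piece and their limits\<close>

lemma pieceD:
  assumes "p \<in> piece V m"
  shows "p \<in> Z" "p t = (\<Sum>v\<in>V. p (xm v t))"
    and "v \<in> V \<Longrightarrow> 1 / (real m + 1) \<le> \<bar>p v\<bar>" "v \<in> V \<Longrightarrow> \<bar>p v\<bar> \<le> real m + 1"
    and "v \<in> V \<Longrightarrow> p (xm v v) = p v"
    and "v \<in> V \<Longrightarrow> p v * p (xm v (xm a b)) = p (xm v a) * p (xm v b)"
  using assms unfolding piece_def piece_conds_def by blast+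

lemma piece_nonzero:
  assumes "p \<in> piece V m" "v \<in> V"
  shows "p v \<noteq> 0"
proof -
  have "1 / (real m + 1) \<le> \<bar>p v\<bar>" using assms by (rule pieceD)
  moreover have "1 / (real m + 1) > 0" by simp
  ultimately show ?thesis by linarith
qed

lemma piece_sum:
  assumes "p \<in> piece V m"
  shows "p t = (\<Sum>v\<in>V. p v * cmpt p v t)"
proof -
  have "p t = (\<Sum>v\<in>V. p (xm v t))" using assms by (rule pieceD)
  also have "\<dots> = (\<Sum>v\<in>V. p v * cmpt p v t)"
    using piece_nonzero[OF assms] by (intro sum.cong) (auto simp: cmpt_def)
  finally show ?thesis .
qed

lemma cmpt_in_X:
  assumes p: "p \<in> piece V m" and v: "v \<in> V"
  shows "cmpt p v \<in> X"
proof (rule character_in_span[where m = xm])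
  show "character xm x" if "x \<in> X" for x using X_character that .
  have nz: "p v \<noteq> 0" using piece_nonzero assms .
  have *: "p v * p (xm v (xm a b)) = p (xm v a) * p (xm v b)" "p (xm v v) = p v" for a b
    using assms by (rule pieceD)+
  have "cmpt p v (xm a b) = cmpt p v a * cmpt p v b" for a b
    using nz *(1)[of a b] by (simp add: cmpt_def field_simps)
  \<comment> \<open>A character must be nonzero somewhere; the condition
    \<open>p (xm v v) = p v\<close> provides the index \<open>v\<close> itself.\<close>
  moreover have "cmpt p v v = 1" using nz * by (simp add: cmpt_def)
  ultimately show "character xm (cmpt p v)" unfolding character_def by (metis zero_neq_one)
  have "(\<lambda>t. inverse (p v) * p (xm v t)) \<in> fun_space.span X"
    by (intro fun_space.span_scale span_shift) (use pieceD(1)[OF p] in \<open>simp add: Z_def\<close>)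
  moreover have "(\<lambda>t. inverse (p v) * p (xm v t)) = cmpt p v"
    by (auto simp: cmpt_def field_simps)
  ultimately show "cmpt p v \<in> fun_space.span X" by simp
qed

lemma continuous_cmpt:
  assumes "v \<in> V"
  shows "continuous_on (piece V m) (\<lambda>p. cmpt p v t)"
  unfolding cmpt_def using assms piece_nonzero
  by (intro continuous_on_divide continuous_on_subset[OF continuous_on_product_coordinates]) auto

text \<open>Properness of the support map in sequential form. The coefficients are bounded, so a
  subsequence of them converges, and \<open>p (r n)\<close> tends to the combination
  \<open>q\<close> of the limit points \<open>z v\<close> with the limit coefficients. The lower
  bound on coefficients keeps \<open>q v\<close> nonzero, so the components of \<open>q\<close> are
  again the \<open>z v\<close>.\<close>

lemma piece_perfect:
  assumes V: "finite V" and p: "\<And>n. p n \<in> piece V m" and z: "\<And>v. v \<in> V \<Longrightarrow> z v \<in> X"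
    and lim: "\<And>v t. v \<in> V \<Longrightarrow> (\<lambda>n. cmpt (p n) v t) \<longlonglongrightarrow> z v t"
  obtains r q where "strict_mono r" "(\<lambda>n. p (r n)) \<longlonglongrightarrow> q" "q \<in> piece V m"
    "\<And>v. v \<in> V \<Longrightarrow> cmpt q v = z v"
proof -
  have "\<bar>p n v\<bar> \<le> real m + 1" if "v \<in> V" for n v
    using p that by (rule pieceD)
  then obtain r l where r: "strict_mono r" and l: "\<And>v. v \<in> V \<Longrightarrow> (\<lambda>n. p (r n) v) \<longlonglongrightarrow> l v"
    using bounded_pointwise_subsequence[of V p "real m + 1"] by blast
  have lim': "(\<lambda>n. cmpt (p (r n)) v t) \<longlonglongrightarrow> z v t" if "v \<in> V" for v t
    using LIMSEQ_subseq_LIMSEQ[OF lim[OF that] r] by (simp add: o_def)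
  define q where "q = (\<Sum>v\<in>V. (\<lambda>t. l v * z v t))"
  have q: "q t = (\<Sum>v\<in>V. l v * z v t)" for t by (simp add: q_def sum_fun_apply)
  have conv: "(\<lambda>n. p (r n) t) \<longlonglongrightarrow> q t" for t
  proof -
    have "(\<lambda>n. p (r n) t) = (\<lambda>n. \<Sum>v\<in>V. p (r n) v * cmpt (p (r n)) v t)"
      by (rule ext, rule piece_sum[OF p])
    then show ?thesis unfolding q by (simp add: tendsto_sum tendsto_mult l lim')
  qed
  then have conv': "(\<lambda>n. p (r n)) \<longlonglongrightarrow> q" by (simp add: tendsto_fun_iff)
  \<comment> \<open>The span need not be closed; membership comes from the explicit form of
    \<open>q\<close> and from \<open>z v \<in> X\<close>. The remaining conditions pass to the
    limit.\<close>
  have "q \<in> fun_space.span X"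
    unfolding q_def by (intro fun_space.span_sum fun_space.span_scale fun_space.span_base z)
  moreover have "q one = 1"
    using conv[of one] pieceD(1)[OF p] by (simp add: Z_def LIMSEQ_const_iff)
  moreover have "q (ym a b) = q a * q b" for a b
  proof (rule LIMSEQ_unique[OF conv])
    have "p (r n) (ym a b) = p (r n) a * p (r n) b" for n
      using pieceD(1)[OF p[of "r n"]] by (simp add: Z_def)
    then show "(\<lambda>n. p (r n) (ym a b)) \<longlonglongrightarrow> q a * q b"
      using tendsto_mult[OF conv conv] by simp
  qed
  moreover have "q \<in> piece_conds V m"
    by (rule closed_sequentially[OF closed_piece_conds _ conv']) (use p in \<open>simp add: piece_def\<close>)
  ultimately have qp: "q \<in> piece V m" by (simp add: piece_def Z_def)
  have "cmpt q v = z v" if v: "v \<in> V" for v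
  proof
    fix t
    have "(\<lambda>n. cmpt (p (r n)) v t) \<longlonglongrightarrow> cmpt q v t"
      unfolding cmpt_def by (intro tendsto_divide conv piece_nonzero[OF qp v])
    then show "cmpt q v t = z v t" using LIMSEQ_unique lim'[OF v] by blast
  qed
  then show ?thesis using that r conv' qp by blast
qed

end

section \<open>Clopen splittings of a single piece\<close>

lemma separate_finite_closed:
  fixes A B E F :: "'i::metric_space set"
  assumes "finite A" "finite B" "A \<inter> B = {}" "closed E" "closed F" "A \<inter> F = {}" "B \<inter> E = {}"
  obtains G H where "open G" "open H" "A \<subseteq> G" "B \<subseteq> H" "G \<inter> H = {}" "G \<inter> F = {}" "H \<inter> E = {}"
proof -
  have "normal_space (euclidean :: 'i topology)"
    by (simp add: metrizable_imp_normal_space metrizable_space_euclidean)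
  then have "closed S \<Longrightarrow> closed T \<Longrightarrow> disjnt S T \<Longrightarrow>
      \<exists>U V. open U \<and> open V \<and> S \<subseteq> U \<and> T \<subseteq> V \<and> disjnt U V" for S T :: "'i set"
    unfolding normal_space_def by simp
  moreover have "closed A" "closed B" using assms by (simp_all add: finite_imp_closed)
  ultimately obtain U V where UV: "open U" "open V" "A \<subseteq> U" "B \<subseteq> V" "disjnt U V"
    using assms(3) by (meson disjnt_def)
  \<comment> \<open>Deleting \<open>F\<close> and \<open>E\<close> loses no point of
    \<open>A\<close> or \<open>B\<close>, which miss them by assumption.\<close>
  show ?thesis
    by (rule that[of "U - F" "V - E"]) (use UV assms in \<open>auto simp: disjnt_def\<close>)
qed

context character_pair
begin

text \<open>For clopen indices \<open>c\<close> this is the preimage of a basic clopen box under the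
  map that sends \<open>p\<close> to its support.\<close>

definition fibre :: "'i set \<Rightarrow> nat \<Rightarrow> ('i \<times> 'i) set \<Rightarrow> ('i \<Rightarrow> real) set" where
  "fibre V m D = {p \<in> piece V m. \<forall>(v, c)\<in>D. cmpt p v c = 1}"

text \<open>The product \<phi> of the components named in \<open>D\<close> is continuous on the
  piece, takes only the values 0 and 1 there, and is 1 exactly on the set in question.\<close>

lemma fibre_clopen:
  assumes "finite D" and D: "\<And>v c. (v, c) \<in> D \<Longrightarrow> v \<in> V \<and> clopen_index c"
  shows "openin (top_of_set (piece V m)) (fibre V m D)"
    and "closedin (top_of_set (piece V m)) (fibre V m D)"
proof -
  define \<phi> where "\<phi> p = (\<Prod>(v, c)\<in>D. cmpt p v c)" for p
  have cont: "continuous_on (piece V m) \<phi>"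
    unfolding \<phi>_def by (intro continuous_on_prod) (use D continuous_cmpt in auto)
  have val: "cmpt p v c = 0 \<or> cmpt p v c = 1" if "p \<in> piece V m" "(v, c) \<in> D" for p v c
    using D[OF that(2)] cmpt_in_X[OF that(1)] unfolding clopen_index_def by blast
  have one: "\<phi> p = 1" if "p \<in> fibre V m D" for p
    unfolding \<phi>_def by (rule prod.neutral) (use that in \<open>auto simp: fibre_def\<close>)
  have zero: "\<phi> p = 0" if p: "p \<in> piece V m" "p \<notin> fibre V m D" for p
  proof -
    obtain v c where "(v, c) \<in> D" "cmpt p v c \<noteq> 1"
      using p unfolding fibre_def by blast
    then show ?thesis
      unfolding \<phi>_def using val[OF p(1)] by (intro prod_zero[OF assms(1)]) force
  qed
  have eq: "fibre V m D = piece V m \<inter> \<phi> -` {1/2<..}" "fibre V m D = piece V m \<inter> \<phi> -` {1}"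
    using one zero by (fastforce simp: fibre_def)+
  show "openin (top_of_set (piece V m)) (fibre V m D)"
    unfolding eq(1) by (rule continuous_openin_preimage_gen[OF cont]) simp
  show "closedin (top_of_set (piece V m)) (fibre V m D)"
    unfolding eq(2) by (rule continuous_closedin_preimage[OF cont]) simp
qed

lemma finite_piece_fibre:
  assumes "finite V"
  shows "finite {q \<in> piece V m. \<forall>v\<in>V. cmpt q v = z v}"
proof (rule finite_subset)
  show "finite {q \<in> fun_space.span (z ` V). character ym q}"
    using assms by (intro finite_characters_in_span) simp
  show "{q \<in> piece V m. \<forall>v\<in>V. cmpt q v = z v} \<subseteq> {q \<in> fun_space.span (z ` V). character ym q}"
  proof safe
    fix q assume q: "q \<in> piece V m" "\<forall>v\<in>V. cmpt q v = z v"
    show "character ym q" using pieceD(1)[OF q(1)] by (rule Z_character)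
    have "q = (\<Sum>v\<in>V. (\<lambda>t. q v * z v t))"
    proof
      fix t
      have "q t = (\<Sum>v\<in>V. q v * cmpt q v t)" by (rule piece_sum[OF q(1)])
      also have "\<dots> = (\<Sum>v\<in>V. q v * z v t)" using q(2) by (intro sum.cong) auto
      finally show "q t = (\<Sum>v\<in>V. (\<lambda>t. q v * z v t)) t" by (simp add: sum_fun_apply)
    qed
    also have "\<dots> \<in> fun_space.span (z ` V)"
      by (intro fun_space.span_sum fun_space.span_scale fun_space.span_base) simp
    finally show "q \<in> fun_space.span (z ` V)" .
  qed
qed

text \<open>Boxes whose preimage can be divided between \<open>E\<close> and \<open>F\<close>. As
  \<open>D\<close> is a finite set of pairs from a countable type, there are only countably
  many.\<close>

definition good :: "'i set \<Rightarrow> nat \<Rightarrow> ('i \<Rightarrow> real) set \<Rightarrow> ('i \<Rightarrow> real) set \<Rightarrow> ('i \<times> 'i) set \<Rightarrow> bool" where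
  "good V m E F D \<longleftrightarrow> finite D \<and> (\<forall>(v, c)\<in>D. v \<in> V \<and> clopen_index c) \<and>
     (\<exists>P Q. openin (top_of_set (piece V m)) P \<and> openin (top_of_set (piece V m)) Q \<and> P \<inter> Q = {}
        \<and> P \<union> Q = fibre V m D \<and> disjnt E Q \<and> disjnt F P)"

text \<open>The fibre of the support map through \<open>p\<close> is finite, so disjoint open sets
  \<open>G\<close> and \<open>H\<close> divide it between \<open>E\<close> and \<open>F\<close>. If
  no box around the support of \<open>p\<close> had its preimage in \<open>G \<union> H\<close>,
  points \<open>q j\<close> outside \<open>G \<union> H\<close> would have supports converging to
  that of \<open>p\<close>; by \<open>piece_perfect\<close> a subsequence would converge to a point
  of the fibre, which lies in the open set \<open>G \<union> H\<close>.\<close>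

lemma good_exists:
  assumes V: "finite V" and E: "closedin (top_of_set Z) E" and F: "closedin (top_of_set Z) F"
    and EF: "disjnt E F" and p: "p \<in> piece V m"
  shows "\<exists>D. good V m E F D \<and> p \<in> fibre V m D"
proof -
  define z where "z v = cmpt p v" for v
  have z: "z v \<in> X" if "v \<in> V" for v unfolding z_def using cmpt_in_X[OF p that] .
  let ?\<Phi> = "{q \<in> piece V m. \<forall>v\<in>V. cmpt q v = z v}"
  have \<Phi>: "finite ?\<Phi>" by (rule finite_piece_fibre[OF V])
  obtain E' F' where EF': "closed E'" "closed F'" "E = Z \<inter> E'" "F = Z \<inter> F'"
    using E F by (auto simp: closedin_closed)
  have \<Phi>Z: "?\<Phi> \<subseteq> Z" using pieceD(1) by blast
  \<comment> \<open>Fibre points in \<open>F\<close> are assigned to \<open>H\<close>, all others to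
    \<open>G\<close>; those in \<open>E\<close> are among the latter.\<close>
  obtain G H where GH: "open G" "open H" "?\<Phi> - F' \<subseteq> G" "?\<Phi> \<inter> F' \<subseteq> H" "G \<inter> H = {}" "G \<inter> F' = {}" "H \<inter> E' = {}"
  proof (rule separate_finite_closed[of "?\<Phi> - F'" "?\<Phi> \<inter> F'" E' F'])
    show "finite (?\<Phi> - F')" "finite (?\<Phi> \<inter> F')" using \<Phi> by auto
    show "?\<Phi> \<inter> F' \<inter> E' = {}" using EF EF'(3,4) \<Phi>Z by (auto simp: disjnt_def)
  qed (use EF' in auto)
  \<comment> \<open>The clopen conditions that the support of \<open>p\<close> satisfies, cut off at
    code \<open>j\<close>; the boxes shrink to that support as \<open>j\<close> grows.\<close>
  define D where "D j = {(v, c). v \<in> V \<and> clopen_index c \<and> z v c = 1 \<and> to_nat c < j}" for j :: nat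
  have D_fin: "finite (D j)" for j
  proof (rule finite_subset)
    show "D j \<subseteq> V \<times> {c. to_nat c < j}" by (auto simp: D_def)
    have "finite (to_nat -` {..<j} :: 'i set)" by (rule finite_vimageI) auto
    then show "finite (V \<times> {c::'i. to_nat c < j})" using V by (simp add: vimage_def)
  qed
  have D_sub: "\<forall>(v, c)\<in>D j. v \<in> V \<and> clopen_index c" for j by (auto simp: D_def)
  have pD: "p \<in> fibre V m (D j)" for j using p by (auto simp: fibre_def D_def z_def)
  show ?thesis
  proof (cases "\<exists>j. fibre V m (D j) \<subseteq> G \<union> H")
    case True
    then obtain j where j: "fibre V m (D j) \<subseteq> G \<union> H" by blast
    have op: "openin (top_of_set (piece V m)) (fibre V m (D j))"
      using D_sub by (intro fibre_clopen(1) D_fin) auto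
    have K: "fibre V m (D j) \<subseteq> piece V m" by (auto simp: fibre_def)
    have op': "openin (top_of_set (piece V m)) (fibre V m (D j) \<inter> S)" if "open S" for S
      using openin_Int[OF op openin_open_Int[OF that, of "piece V m"]] K
      by (simp add: Int_assoc[symmetric] inf.absorb1)
    have "good V m E F (D j)"
      unfolding good_def
    proof (intro conjI)
      show "\<exists>P Q. openin (top_of_set (piece V m)) P \<and> openin (top_of_set (piece V m)) Q \<and> P \<inter> Q = {}
          \<and> P \<union> Q = fibre V m (D j) \<and> disjnt E Q \<and> disjnt F P"
      proof (rule exI[of _ "fibre V m (D j) \<inter> G"], rule exI[of _ "fibre V m (D j) \<inter> H"], intro conjI)
        show "disjnt E (fibre V m (D j) \<inter> H)" "disjnt F (fibre V m (D j) \<inter> G)"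
          using GH EF' by (auto simp: disjnt_def)
      qed (use op' GH j in auto)
    qed (use D_fin D_sub in auto)
    then show ?thesis using pD by blast
  next
    case False
    then have "\<forall>j. \<exists>q. q \<in> fibre V m (D j) \<and> q \<notin> G \<union> H" by blast
    then obtain q where q: "\<And>j. q j \<in> fibre V m (D j)" "\<And>j. q j \<notin> G \<union> H" by metis
    have qp: "q j \<in> piece V m" for j using q(1)[of j] by (simp add: fibre_def)
    have lim: "(\<lambda>j. cmpt (q j) v t) \<longlonglongrightarrow> z v t" if v: "v \<in> V" for v t
    proof (rule LIMSEQ_I)
      fix e :: real assume "0 < e"
      from X_local[OF this, of t "z v t"] obtain c where c: "\<forall>x\<in>X. x c = 0 \<or> x c = 1"
          "\<forall>x\<in>X. x t = z v t \<longrightarrow> x c = 1" "\<forall>x\<in>X. x c = 1 \<longrightarrow> \<bar>x t - z v t\<bar> < e"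
        by blast
      \<comment> \<open>The successor reflects the strict inequality \<open>to_nat c < j\<close> in
        \<open>D j\<close>.\<close>
      have "norm (cmpt (q j) v t - z v t) < e" if "j \<ge> Suc (to_nat c)" for j
      proof -
        have "(v, c) \<in> D j" using v c z[OF v] that by (auto simp: D_def clopen_index_def)
        then have "cmpt (q j) v c = 1" using q(1)[of j] by (auto simp: fibre_def)
        then show ?thesis using c(3) cmpt_in_X[OF qp[of j] v] by auto
      qed
      then show "\<exists>no. \<forall>j\<ge>no. norm (cmpt (q j) v t - z v t) < e" by blast
    qed
    obtain r q' where r: "strict_mono r" "(\<lambda>j. q (r j)) \<longlonglongrightarrow> q'" "q' \<in> piece V m"
        "\<And>v. v \<in> V \<Longrightarrow> cmpt q' v = z v"
      using piece_perfect[OF V qp z lim] by blast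
    have "q' \<in> G \<union> H" using r(3,4) GH(3,4) by blast
    then have "eventually (\<lambda>j. q (r j) \<in> G \<union> H) sequentially"
      using topological_tendstoD[OF r(2) open_Un[OF GH(1,2)]] by blast
    then show ?thesis using q(2) by simp
  qed
qed

text \<open>The preimages of the good boxes are a countable clopen cover of the piece, each already
  divided; \<open>clopen_split_countable\<close> merges the divisions. The results are closed in
  \<open>Z\<close> because the piece is.\<close>

lemma piece_split:
  assumes V: "finite V" and E: "closedin (top_of_set Z) E" and F: "closedin (top_of_set Z) F"
    and EF: "disjnt E F"
  shows "\<exists>P Q. closedin (top_of_set Z) P \<and> closedin (top_of_set Z) Q \<and> disjnt P Q
    \<and> P \<union> Q = piece V m \<and> disjnt E Q \<and> disjnt F P"
proof (cases "piece V m = {}")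
  case True
  then show ?thesis by (intro exI[of _ "{}"]) auto
next
  case False
  let ?G = "{D. good V m E F D}"
  have "?G \<noteq> {}" using good_exists[OF V E F EF] False by blast
  moreover have "countable ?G"
    by (rule countable_subset[OF _ countable_Collect_finite]) (auto simp: good_def)
  ultimately have G: "range (from_nat_into ?G) = ?G" by (rule range_from_nat_into)
  define D where "D = from_nat_into ?G"
  have D: "good V m E F (D n)" for n using G by (auto simp: D_def)
  have "\<exists>P Q. openin (top_of_set (piece V m)) P \<and> openin (top_of_set (piece V m)) Q \<and> P \<inter> Q = {}
        \<and> P \<union> Q = fibre V m (D n) \<and> disjnt E Q \<and> disjnt F P" for n
    using D[of n] by (simp add: good_def)
  then have "\<exists>P. \<forall>n. \<exists>Q. openin (top_of_set (piece V m)) (P n) \<and> openin (top_of_set (piece V m)) Q \<and> P n \<inter> Q = {}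
        \<and> P n \<union> Q = fibre V m (D n) \<and> disjnt E Q \<and> disjnt F (P n)"
    by (intro choice) blast
  then obtain P where "\<forall>n. \<exists>Q. openin (top_of_set (piece V m)) (P n) \<and> openin (top_of_set (piece V m)) Q \<and> P n \<inter> Q = {}
        \<and> P n \<union> Q = fibre V m (D n) \<and> disjnt E Q \<and> disjnt F (P n)" by blast
  from choice[OF this] obtain Q where PQ: "\<And>n. openin (top_of_set (piece V m)) (P n)"
      "\<And>n. openin (top_of_set (piece V m)) (Q n)" "\<And>n. P n \<inter> Q n = {}" "\<And>n. P n \<union> Q n = fibre V m (D n)"
      "\<And>n. disjnt E (Q n)" "\<And>n. disjnt F (P n)" by blast
  have "closedin (top_of_set (piece V m)) (P n \<union> Q n)" for n
    unfolding PQ(4) using D[of n] by (intro fibre_clopen(2)) (auto simp: good_def)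
  moreover have "topspace (top_of_set (piece V m)) \<subseteq> (\<Union>n. P n \<union> Q n)"
  proof
    fix p assume "p \<in> topspace (top_of_set (piece V m))"
    then obtain D' where "good V m E F D'" "p \<in> fibre V m D'"
      using good_exists[OF V E F EF] by auto
    moreover then obtain n where "D n = D'" using G unfolding D_def by (metis (no_types, lifting) imageE mem_Collect_eq)
    ultimately show "p \<in> (\<Union>n. P n \<union> Q n)" unfolding PQ(4) by blast
  qed
  ultimately obtain A B where "closedin (top_of_set (piece V m)) A" "closedin (top_of_set (piece V m)) B"
      "disjnt A B" "A \<union> B = piece V m" "disjnt E B" "disjnt F A"
    using clopen_split_countable[of "top_of_set (piece V m)" P Q E F] PQ by auto
  then show ?thesis using closedin_trans[OF _ closedin_piece] by blast
qed

lemma pieces_cover: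
  assumes p: "p \<in> Z"
  obtains V m where "finite V" "p \<in> piece V m"
proof -
  have "p \<in> fun_space.span X" using p by (simp add: Z_def)
  then obtain F0 c where F0: "finite F0" "F0 \<subseteq> X" "p = (\<Sum>x\<in>F0. (\<lambda>t. c x * x t))"
    unfolding fun_space.span_explicit by blast
  define F where "F = {x\<in>F0. c x \<noteq> 0}"
  have F: "finite F" "F \<subseteq> X" and c: "\<And>x. x \<in> F \<Longrightarrow> c x \<noteq> 0" using F0 by (auto simp: F_def)
  have pF: "p t = (\<Sum>x\<in>F. c x * x t)" for t
  proof -
    have "p t = (\<Sum>x\<in>F0. c x * x t)" unfolding F0(3) sum_fun_apply ..
    also have "\<dots> = (\<Sum>x\<in>F. c x * x t)"
      using F0(1) by (intro sum.mono_neutral_right) (auto simp: F_def)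
    finally show ?thesis .
  qed
  have "\<exists>v. x v = 1 \<and> (\<forall>y\<in>F - {x}. y v = 0)" if "x \<in> F" for x
    using X_separating_finite[of "F - {x}" x] F that by blast
  then obtain v where v: "\<And>x. x \<in> F \<Longrightarrow> x (v x) = 1" "\<And>x y. x \<in> F \<Longrightarrow> y \<in> F \<Longrightarrow> y \<noteq> x \<Longrightarrow> y (v x) = 0"
    by (metis Diff_iff singletonD)
  \<comment> \<open>The piece sums over indices, not over points of \<open>F\<close>; injectivity
    makes the two sums agree.\<close>
  have inj: "inj_on v F"
    by (rule inj_onI) (metis v zero_neq_one)
  have pick: "(\<Sum>y\<in>F. c y * y (v x) * s y) = c x * s x" if "x \<in> F" for x s
  proof -
    have "(\<Sum>y\<in>F. c y * y (v x) * s y) = (\<Sum>y\<in>F. if y = x then c x * s x else 0)"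
      using v that by (intro sum.cong) auto
    then show ?thesis using that F by simp
  qed
  have pv: "p (v x) = c x" if "x \<in> F" for x
    using pick[OF that, of "\<lambda>_. 1"] by (simp add: pF)
  have pxm: "p (xm (v x) t) = c x * x t" if "x \<in> F" for x t
  proof -
    have "p (xm (v x) t) = (\<Sum>y\<in>F. c y * y (v x) * y t)"
      unfolding pF using F(2) X_mult by (intro sum.cong) auto
    then show ?thesis using pick[OF that] by simp
  qed
  \<comment> \<open>A single number that dominates every coefficient and every reciprocal of a
    coefficient in absolute value.\<close>
  define M where "M = (\<Sum>x\<in>F. \<bar>c x\<bar> + 1 / \<bar>c x\<bar>)"
  obtain m :: nat where m: "M \<le> real m" using real_arch_simple by blast
  have bound: "\<bar>c x\<bar> \<le> real m + 1" "1 / (real m + 1) \<le> \<bar>c x\<bar>" if x: "x \<in> F" for x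
  proof -
    have "\<bar>c x\<bar> + 1 / \<bar>c x\<bar> \<le> M"
      unfolding M_def by (rule member_le_sum[OF x]) (use F in auto)
    then have "\<bar>c x\<bar> + 1 / \<bar>c x\<bar> \<le> real m + 1" using m by simp
    moreover have pos: "\<bar>c x\<bar> > 0" "1 / \<bar>c x\<bar> > 0" using c[OF x] by auto
    ultimately show "\<bar>c x\<bar> \<le> real m + 1" by linarith
    have "1 / \<bar>c x\<bar> \<le> real m + 1" using \<open>\<bar>c x\<bar> + 1 / \<bar>c x\<bar> \<le> real m + 1\<close> pos by linarith
    then show "1 / (real m + 1) \<le> \<bar>c x\<bar>" using pos(1) by (simp add: field_simps)
  qed
  have "p \<in> piece_conds (v ` F) m"
    unfolding piece_conds_def
  proof (intro CollectI conjI allI impI)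
    fix t
    have "p t = (\<Sum>x\<in>F. p (xm (v x) t))" using pxm by (simp add: pF)
    then show "p t = (\<Sum>w\<in>v ` F. p (xm w t))" by (simp only: sum.reindex[OF inj] o_def)
  next
    fix w assume "w \<in> v ` F"
    then obtain x where x: "x \<in> F" "w = v x" by blast
    show "1 / (real m + 1) \<le> \<bar>p w\<bar>" "\<bar>p w\<bar> \<le> real m + 1" using bound[OF x(1)] by (simp_all add: x pv)
    show "p (xm w w) = p w" using x v(1) by (simp add: pv pxm)
    fix a b
    have "x (xm a b) = x a * x b" using x(1) F(2) X_mult by blast
    then show "p w * p (xm w (xm a b)) = p (xm w a) * p (xm w b)" using x by (simp add: pv pxm)
  qed
  then show ?thesis using that[of "v ` F" m] p F by (simp add: piece_def)
qed

text \<open>There are countably many pairs of a finite \<open>V\<close> and a bound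
  \<open>m\<close>, so the countable sum theorem applies to the closed pieces in \<open>Z\<close>,
  which is metrizable and hence normal.\<close>

theorem clopen_separation:
  assumes "closedin (top_of_set Z) E" "closedin (top_of_set Z) F" "disjnt E F"
  obtains C where "openin (top_of_set Z) C" "closedin (top_of_set Z) C" "E \<subseteq> C" "disjnt F C"
proof -
  let ?I = "{V::'i set. finite V} \<times> (UNIV :: nat set)"
  have "countable ?I" by (intro countable_SIGMA countable_Collect_finite) auto
  moreover have "?I \<noteq> {}" by auto
  ultimately have I: "range (from_nat_into ?I) = ?I" by (intro range_from_nat_into)
  define K where "K n = (\<lambda>(V, m). piece V m) (from_nat_into ?I n)" for n
  have K: "\<exists>V m. finite V \<and> K n = piece V m" for n
  proof -
    have "from_nat_into ?I n \<in> ?I" using I by blast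
    then show ?thesis by (cases "from_nat_into ?I n") (auto simp: K_def)
  qed
  have "metrizable_space (top_of_set Z)"
    by (simp add: metrizable_space_euclidean metrizable_space_subtopology)
  then have "normal_space (top_of_set Z)" by (rule metrizable_imp_normal_space)
  moreover have "closedin (top_of_set Z) (K n)" for n using K[of n] closedin_piece by auto
  moreover have "topspace (top_of_set Z) \<subseteq> (\<Union>n. K n)"
  proof
    fix p assume "p \<in> topspace (top_of_set Z)"
    then obtain V m where Vm: "finite V" "p \<in> piece V m" using pieces_cover by auto
    have "(V, m) \<in> range (from_nat_into ?I)" unfolding I using Vm by simp
    then obtain n where "from_nat_into ?I n = (V, m)" by auto
    then have "p \<in> K n" using Vm by (simp add: K_def)
    then show "p \<in> (\<Union>n. K n)" by blast
  qed
  moreover have "\<exists>P Q. closedin (top_of_set Z) P \<and> closedin (top_of_set Z) Q \<and> disjnt P Q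
      \<and> P \<union> Q = K n \<and> disjnt E Q \<and> disjnt F P"
    if "closedin (top_of_set Z) E" "closedin (top_of_set Z) F" "disjnt E F" for n E F
    using K[of n] piece_split[OF _ that] by auto
  ultimately show ?thesis
    by (rule normal_space_clopen_separation[OF _ assms]) (assumption | rule that)+
qed

end

subsection \<open>Zero-dimensionality and clopen sets\<close>

lemma continuous_map_indicator:
  assumes "openin X U" "closedin X U"
  shows "continuous_map X euclideanreal (indicator U)"
proof -
  have "openin X {x \<in> topspace X. (indicator U x :: real) \<in> V}" for V
  proof -
    have "{x \<in> topspace X. (indicator U x :: real) \<in> V} =
        (if 1 \<in> V then U else {}) \<union> (if 0 \<in> V then topspace X - U else {})"
      using openin_subset[OF assms(1)] by (auto simp: indicator_def)
    also have "openin X \<dots>" using assms by auto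
    finally show ?thesis .
  qed
  then show ?thesis by (simp add: continuous_map_def)
qed

lemma functionally_open_imp_openin: "functionally_open X U \<Longrightarrow> openin X U"
proof -
  assume "functionally_open X U"
  then obtain f where f: "continuous_map X euclideanreal f" "U = {x \<in> topspace X. f x \<noteq> 0}"
    by (auto simp: functionally_open_def)
  have "openin euclideanreal (- {0})" by (simp add: open_Compl)
  from openin_continuous_map_preimage[OF f(1) this] show ?thesis using f(2) by simp
qed

lemma functionally_open_less:
  assumes "continuous_map X euclideanreal f" "continuous_map X euclideanreal g"
  shows "functionally_open X {x \<in> topspace X. f x < g x}"
  unfolding functionally_open_def
  by (rule exI[of _ "\<lambda>x. max (g x - f x) 0"])
    (use assms in \<open>auto intro!: continuous_map_real_max continuous_map_diff\<close>)

lemma functionally_open_clopen: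
  assumes "openin X U" "closedin X U"
  shows "functionally_open X U"
  unfolding functionally_open_def
  by (rule exI[of _ "indicator U"])
    (use assms openin_subset[OF assms(1)] in \<open>auto simp: continuous_map_indicator indicator_def\<close>)

text \<open>In \<open>enat\<close> a nonempty infimum is attained, and the infimum of the empty set
  is infinite rather than 0.\<close>

lemma covering_dim_eq_0_iff: "covering_dim X = 0 \<longleftrightarrow> covering_dim_le X 0"
proof
  assume *: "covering_dim X = 0"
  have "{enat n |n. covering_dim_le X n} \<noteq> {}"
  proof
    assume "{enat n |n. covering_dim_le X n} = {}"
    then have "covering_dim X = \<infinity>" unfolding covering_dim_def by (simp add: top_enat_def)
    then show False using * by simp
  qed
  then have "Inf {enat n |n. covering_dim_le X n} \<in> {enat n |n. covering_dim_le X n}"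
    by (metis (no_types, lifting) ex_in_conv wellorder_InfI)
  then show "covering_dim_le X 0" using * by (auto simp: covering_dim_def zero_enat_def)
next
  assume "covering_dim_le X 0"
  then have "covering_dim X \<le> enat 0" unfolding covering_dim_def by (intro Inf_lower) auto
  then show "covering_dim X = 0" by (simp add: zero_enat_def[symmetric])
qed

text \<open>A refinement of the cover by \<open>f < b\<close> and \<open>f > a\<close> of order 0
  has pairwise disjoint members. The union of those inside \<open>f < b\<close> is clopen, its
  complement being the union of the others.\<close>

lemma covering_dim_0_clopen:
  assumes "covering_dim_le X 0" "continuous_map X euclideanreal f" "a < b"
  obtains U where "openin X U" "closedin X U" "\<And>x. x \<in> topspace X \<Longrightarrow> f x \<le> a \<Longrightarrow> x \<in> U"
    "\<And>x. x \<in> U \<Longrightarrow> f x < b"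
proof -
  define A B where "A = {x \<in> topspace X. f x < b}" and "B = {x \<in> topspace X. a < f x}"
  have "finite_functionally_open_cover X {A, B}"
    using assms(2,3) functionally_open_less[OF assms(2), of "\<lambda>_. b"]
      functionally_open_less[OF _ assms(2), of "\<lambda>_. a"]
    by (auto simp: finite_functionally_open_cover_def A_def B_def)
  then obtain \<V> where V: "finite_functionally_open_cover X \<V>" "cover_refines \<V> {A, B}"
      "\<forall>x\<in>topspace X. card {V \<in> \<V>. x \<in> V} \<le> 0 + 1"
    using assms(1) unfolding covering_dim_le_def by blast
  have fin: "finite \<V>" and un: "\<Union>\<V> = topspace X" and op: "\<And>V. V \<in> \<V> \<Longrightarrow> openin X V"
    using V(1) functionally_open_imp_openin by (auto simp: finite_functionally_open_cover_def)
  have uniq: "V = W" if "V \<in> \<V>" "W \<in> \<V>" "x \<in> V" "x \<in> W" for V W x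
  proof -
    have "x \<in> topspace X" using that un by blast
    then have "card {V \<in> \<V>. x \<in> V} \<le> 1" using V(3) by simp
    moreover have "finite {V \<in> \<V>. x \<in> V}" using fin by simp
    ultimately show ?thesis using that card_le_Suc0_iff_eq[of "{V \<in> \<V>. x \<in> V}"] by auto
  qed
  define U where "U = \<Union>{V \<in> \<V>. V \<subseteq> A}"
  have "openin X U" unfolding U_def using op by (intro openin_Union) auto
  moreover have "topspace X - U = \<Union>{V \<in> \<V>. \<not> V \<subseteq> A}"
    unfolding U_def un[symmetric] using uniq by blast
  then have "openin X (topspace X - U)" using op by (auto intro!: openin_Union)
  then have "closedin X U" using openin_subset[OF \<open>openin X U\<close>] by (simp add: closedin_def)
  moreover have "x \<in> U" if x: "x \<in> topspace X" "f x \<le> a" for x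
  proof -
    obtain V where V': "V \<in> \<V>" "x \<in> V" using x un by blast
    moreover have "x \<notin> B" using x by (simp add: B_def)
    ultimately have "V \<subseteq> A" using V(2) unfolding cover_refines_def by blast
    then show ?thesis using V' unfolding U_def by blast
  qed
  moreover have "f x < b" if "x \<in> U" for x using that by (auto simp: U_def A_def)
  ultimately show ?thesis using that by blast
qed

lemma clopen_disjointify:
  assumes "finite \<U>" "\<And>U. U \<in> \<U> \<Longrightarrow> openin Y (C U) \<and> closedin Y (C U)"
  shows "\<exists>W. (\<forall>U\<in>\<U>. openin Y (W U) \<and> closedin Y (W U) \<and> W U \<subseteq> C U) \<and> disjoint_family_on W \<U>
      \<and> (\<Union>U\<in>\<U>. W U) = (\<Union>U\<in>\<U>. C U)"
  using assms
proof (induction \<U> rule: finite_induct)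
  case empty
  then show ?case by (simp add: disjoint_family_on_def)
next
  case (insert U0 \<U>)
  then obtain W where W: "\<And>U. U \<in> \<U> \<Longrightarrow> openin Y (W U) \<and> closedin Y (W U) \<and> W U \<subseteq> C U"
      "disjoint_family_on W \<U>" "(\<Union>U\<in>\<U>. W U) = (\<Union>U\<in>\<U>. C U)"
    by auto
  define S where "S = (\<Union>U\<in>\<U>. W U)"
  define W' where "W' = W(U0 := C U0 - S)"
  have S: "openin Y S" "closedin Y S"
    unfolding S_def using W(1) insert.hyps(1) by (auto intro!: openin_Union closedin_Union)
  have eq: "W' U = W U" if "U \<in> \<U>" for U using that insert.hyps(2) by (auto simp: W'_def)
  have eq0: "W' U0 = C U0 - S" by (simp add: W'_def)
  have "\<forall>U\<in>insert U0 \<U>. openin Y (W' U) \<and> closedin Y (W' U) \<and> W' U \<subseteq> C U"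
    using W(1) eq eq0 S insert.prems by (auto simp: openin_diff closedin_diff)
  moreover have "disjoint_family_on W' (insert U0 \<U>)"
  proof -
    have "W' U0 \<inter> W' U = {}" if "U \<in> \<U>" for U using that eq eq0 by (auto simp: S_def)
    then show ?thesis
      using W(2) eq insert.hyps(2) unfolding disjoint_family_on_def by (metis Int_commute insertE)
  qed
  moreover have "(\<Union>U\<in>insert U0 \<U>. W' U) = (C U0 - S) \<union> S"
    using eq eq0 by (auto simp: S_def)
  then have "(\<Union>U\<in>insert U0 \<U>. W' U) = (\<Union>U\<in>insert U0 \<U>. C U)"
    using W(3) by (auto simp: S_def)
  ultimately show ?case by blast
qed

text \<open>The functions \<open>h U\<close> vanish off \<open>U\<close>, and at each point at least
  one of them is 1. Separating the levels 0 and 1 of each therefore yields clopen sets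
  \<open>C' U\<close> inside \<open>U\<close> that still cover; making them disjoint gives a
  refinement of order 0.\<close>

lemma covering_dim_le_0I:
  assumes sep: "\<And>h. continuous_map Y euclideanreal h \<Longrightarrow> (\<And>y. y \<in> topspace Y \<Longrightarrow> 0 \<le> h y \<and> h y \<le> 1) \<Longrightarrow>
    \<exists>C. openin Y C \<and> closedin Y C \<and> (\<forall>y\<in>topspace Y. (h y \<le> 0 \<longrightarrow> y \<in> C) \<and> (h y \<ge> 1 \<longrightarrow> y \<notin> C))"
  shows "covering_dim_le Y 0"
  unfolding covering_dim_le_def
proof (intro allI impI)
  fix \<U> assume "finite_functionally_open_cover Y \<U>"
  then have fin: "finite \<U>" and un: "\<Union>\<U> = topspace Y" and fo: "\<forall>U\<in>\<U>. functionally_open Y U"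
    by (auto simp: finite_functionally_open_cover_def)
  from fo obtain u where u: "\<And>U. U \<in> \<U> \<Longrightarrow> continuous_map Y euclideanreal (u U)"
      and eq: "\<And>U. U \<in> \<U> \<Longrightarrow> U = {y \<in> topspace Y. u U y \<noteq> 0}"
    unfolding functionally_open_def by metis
  have u_nz: "y \<in> U \<longleftrightarrow> y \<in> topspace Y \<and> u U y \<noteq> 0" if "U \<in> \<U>" for U y
    using eq[OF that] by blast
  define s where "s y = (\<Sum>U\<in>\<U>. \<bar>u U y\<bar>)" for y
  have s_pos: "s y > 0" if y: "y \<in> topspace Y" for y
  proof -
    obtain U where "U \<in> \<U>" "y \<in> U" using y un by blast
    then have "\<bar>u U y\<bar> > 0" using u_nz by simp
    then show ?thesis
      unfolding s_def using \<open>U \<in> \<U>\<close> fin by (intro sum_pos2[of _ U]) auto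
  qed
  \<comment> \<open>At each point some \<open>|u U y|\<close> is at least the average
    \<open>s y / card \<U>\<close>, and for that \<open>U\<close> the minimum is 1.\<close>
  define h where "h U y = min 1 (real (card \<U>) * \<bar>u U y\<bar> / s y)" for U y
  have h_cont: "continuous_map Y euclideanreal (h U)" if U: "U \<in> \<U>" for U
  proof -
    have "continuous_map Y euclideanreal s"
      unfolding s_def using u fin by (intro continuous_map_sum continuous_map_real_abs) auto
    moreover have "s y \<noteq> 0" if "y \<in> topspace Y" for y using s_pos[OF that] by simp
    ultimately show ?thesis
      unfolding h_def
      by (intro continuous_map_real_min continuous_map_real_divide continuous_map_real_mult
          continuous_map_real_abs u[OF U]) auto
  qed
  have h_range: "0 \<le> h U y \<and> h U y \<le> 1" if "y \<in> topspace Y" for U y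
    using s_pos[OF that] by (simp add: h_def)
  have h_zero: "h U y = 0" if "U \<in> \<U>" "y \<in> topspace Y" "y \<notin> U" for U y
    using that u_nz[OF that(1), of y] by (simp add: h_def)
  have h_one: "\<exists>U\<in>\<U>. h U y = 1" if y: "y \<in> topspace Y" for y
  proof (rule ccontr)
    assume "\<not> (\<exists>U\<in>\<U>. h U y = 1)"
    then have neq: "h U y \<noteq> 1" if "U \<in> \<U>" for U using that by blast
    have lt: "real (card \<U>) * \<bar>u U y\<bar> < s y" if "U \<in> \<U>" for U
    proof (rule ccontr)
      assume "\<not> real (card \<U>) * \<bar>u U y\<bar> < s y"
      then have "1 \<le> real (card \<U>) * \<bar>u U y\<bar> / s y" using s_pos[OF y] by simp
      then show False using neq[OF that] by (simp add: h_def)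
    qed
    have ne: "\<U> \<noteq> {}" using y un by blast
    then have "(\<Sum>U\<in>\<U>. real (card \<U>) * \<bar>u U y\<bar>) < (\<Sum>U\<in>\<U>. s y)"
      using fin lt by (intro sum_strict_mono) auto
    then show False by (simp add: sum_distrib_left[symmetric] s_def)
  qed
  have "\<forall>U\<in>\<U>. \<exists>C. openin Y C \<and> closedin Y C \<and> (\<forall>y\<in>topspace Y. (h U y \<le> 0 \<longrightarrow> y \<in> C) \<and> (h U y \<ge> 1 \<longrightarrow> y \<notin> C))"
    using sep h_cont h_range by blast
  from bchoice[OF this] obtain C where C: "\<And>U. U \<in> \<U> \<Longrightarrow> openin Y (C U) \<and> closedin Y (C U)"
      "\<And>U y. U \<in> \<U> \<Longrightarrow> y \<in> topspace Y \<Longrightarrow> (h U y \<le> 0 \<longrightarrow> y \<in> C U) \<and> (h U y \<ge> 1 \<longrightarrow> y \<notin> C U)"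
    by blast
  define C' where "C' U = topspace Y - C U" for U
  have "openin Y (C' U) \<and> closedin Y (C' U)" if "U \<in> \<U>" for U
    unfolding C'_def using C(1)[OF that] by auto
  then have "\<exists>W. (\<forall>U\<in>\<U>. openin Y (W U) \<and> closedin Y (W U) \<and> W U \<subseteq> C' U) \<and> disjoint_family_on W \<U>
      \<and> (\<Union>U\<in>\<U>. W U) = (\<Union>U\<in>\<U>. C' U)"
    by (rule clopen_disjointify[OF fin])
  then obtain W where
    W': "\<forall>U\<in>\<U>. openin Y (W U) \<and> closedin Y (W U) \<and> W U \<subseteq> C' U" and
    W2: "disjoint_family_on W \<U>" and W3: "(\<Union>U\<in>\<U>. W U) = (\<Union>U\<in>\<U>. C' U)"
    by (elim exE conjE) (rule that)
  have W: "openin Y (W U) \<and> closedin Y (W U) \<and> W U \<subseteq> C' U" if "U \<in> \<U>" for U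
    using W' that by (rule bspec)
  have sub: "W U \<subseteq> U" if U: "U \<in> \<U>" for U
  proof
    fix y assume "y \<in> W U"
    then have y: "y \<in> topspace Y" "y \<notin> C U" using W[OF U] by (auto simp: C'_def)
    then show "y \<in> U" using C(2)[OF U y(1)] h_zero[OF U y(1)] by (metis order_refl)
  qed
  have cov: "topspace Y \<subseteq> (\<Union>U\<in>\<U>. W U)"
  proof
    fix y assume y: "y \<in> topspace Y"
    obtain U where U: "U \<in> \<U>" "h U y = 1" using h_one[OF y] by blast
    then have "y \<in> C' U" using C(2)[OF U(1) y] y by (simp add: C'_def)
    then show "y \<in> (\<Union>U\<in>\<U>. W U)" unfolding W3 using U by blast
  qed
  show "\<exists>\<V>. finite_functionally_open_cover Y \<V> \<and> cover_refines \<V> \<U> \<and>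
             (\<forall>x\<in>topspace Y. card {V \<in> \<V>. x \<in> V} \<le> 0 + 1)"
  proof (intro exI conjI ballI)
    have "\<Union> (W ` \<U>) \<subseteq> topspace Y" using W openin_subset by blast
    then show "finite_functionally_open_cover Y (W ` \<U>)"
      using fin W functionally_open_clopen cov unfolding finite_functionally_open_cover_def by blast
    show "cover_refines (W ` \<U>) \<U>" using sub by (auto simp: cover_refines_def)
    fix y
    have "V = V'" if V: "V \<in> W ` \<U>" "V' \<in> W ` \<U>" "y \<in> V" "y \<in> V'" for V V'
    proof -
      obtain U U' where U: "U \<in> \<U>" "V = W U" "U' \<in> \<U>" "V' = W U'" using V(1,2) by auto
      then show ?thesis using disjoint_family_onD[OF W2 U(1,3)] V(3,4) by auto
    qed
    then show "card {V \<in> W ` \<U>. y \<in> V} \<le> 0 + 1"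
      using fin by (simp add: card_le_Suc0_iff_eq)
  qed
qed

subsection \<open>Functionals on spaces of continuous functions\<close>

lemma D_fun:
  assumes "D \<in> {C_fun X, C_bounded_fun X}"
  shows D_extensional: "f \<in> D \<Longrightarrow> f \<in> extensional (topspace X)"
    and D_continuous: "f \<in> D \<Longrightarrow> continuous_map X euclideanreal f"
    and D_I: "continuous_map X euclideanreal g \<Longrightarrow> bounded (g ` topspace X) \<Longrightarrow> restrict g (topspace X) \<in> D"
proof -
  show "f \<in> D \<Longrightarrow> f \<in> extensional (topspace X)" "f \<in> D \<Longrightarrow> continuous_map X euclideanreal f"
    using assms by (auto simp: C_fun_def C_bounded_fun_def)
  assume g: "continuous_map X euclideanreal g" "bounded (g ` topspace X)"
  have "continuous_map X euclideanreal (restrict g (topspace X))"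
    by (rule continuous_map_eq[OF g(1)]) simp
  moreover have "restrict g (topspace X) ` topspace X = g ` topspace X" by (rule image_cong) auto
  ultimately show "restrict g (topspace X) \<in> D"
    using assms g(2) by (auto simp: C_fun_def C_bounded_fun_def)
qed

lemma D_closed:
  assumes D: "D \<in> {C_fun X, C_bounded_fun X}" and f: "f \<in> D" and g: "g \<in> D"
  shows D_add: "(\<lambda>x\<in>topspace X. f x + g x) \<in> D"
    and D_mult: "(\<lambda>x\<in>topspace X. f x * g x) \<in> D"
    and D_scale: "(\<lambda>x\<in>topspace X. c * f x) \<in> D"
proof -
  have fg: "continuous_map X euclideanreal f" "continuous_map X euclideanreal g"
    using D_continuous[OF D] f g by auto
  have *: "restrict k (topspace X) \<in> D" if k: "continuous_map X euclideanreal k"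
    and b: "bounded (f ` topspace X) \<Longrightarrow> bounded (g ` topspace X) \<Longrightarrow> bounded (k ` topspace X)" for k
  proof (cases "D = C_fun X")
    case True
    have "continuous_map X euclideanreal (restrict k (topspace X))"
      by (rule continuous_map_eq[OF k]) simp
    then show ?thesis using True by (simp add: C_fun_def)
  next
    case False
    then have "D = C_bounded_fun X" using D by auto
    then show ?thesis using D_I[OF D k] b f g by (simp add: C_bounded_fun_def)
  qed
  show "(\<lambda>x\<in>topspace X. f x + g x) \<in> D"
    by (rule *) (use fg in \<open>auto intro!: continuous_map_add bounded_plus_comp\<close>)
  show "(\<lambda>x\<in>topspace X. f x * g x) \<in> D"
  proof (rule *)
    show "continuous_map X euclideanreal (\<lambda>x. f x * g x)"
      using fg by (intro continuous_map_real_mult)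
    assume "bounded (f ` topspace X)" "bounded (g ` topspace X)"
    then obtain a b where ab: "\<forall>x\<in>topspace X. \<bar>f x\<bar> \<le> a" "\<forall>x\<in>topspace X. \<bar>g x\<bar> \<le> b"
      unfolding bounded_iff by auto
    have "\<bar>f x * g x\<bar> \<le> a * b" if "x \<in> topspace X" for x
      unfolding abs_mult using ab that by (intro mult_mono) (auto intro: order_trans[OF abs_ge_zero])
    then show "bounded ((\<lambda>x. f x * g x) ` topspace X)" unfolding bounded_iff by auto
  qed
  show "(\<lambda>x\<in>topspace X. c * f x) \<in> D"
  proof (rule *)
    show "continuous_map X euclideanreal (\<lambda>x. c * f x)"
      using fg by (intro continuous_map_real_mult_left)
    assume "bounded (f ` topspace X)"
    from bounded_scaling[OF this, of c] show "bounded ((\<lambda>x. c * f x) ` topspace X)"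
      by (simp add: image_image)
  qed
qed

text \<open>Complete regularity applies because finite sets are closed. Its function has values in
  the unit interval, so the bump belongs to both kinds of \<open>D\<close>.\<close>

lemma tychonoff_bump:
  assumes "tychonoff_space X" "finite F" "F \<subseteq> topspace X" "x \<in> F" "D \<in> {C_fun X, C_bounded_fun X}"
  shows "\<exists>e\<in>D. e x = 1 \<and> (\<forall>z\<in>F - {x}. e z = 0)"
proof -
  have "closedin X (F - {x})"
    using assms Hausdorff_imp_t1_space t1_space_closedin_finite unfolding tychonoff_space_def by blast
  moreover have "x \<in> topspace X - (F - {x})" using assms by auto
  moreover have "completely_regular_space X" using assms by (simp add: tychonoff_space_def)
  ultimately obtain f where f: "continuous_map X (top_of_set {0..1::real}) f" "f x = 0" "f ` (F - {x}) \<subseteq> {1}"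
    unfolding completely_regular_space_def by blast
  have cf: "continuous_map X euclideanreal f" and range: "f ` topspace X \<subseteq> {0..1}"
    using f(1) by (auto simp: continuous_map_in_subtopology)
  define e where "e = (\<lambda>x\<in>topspace X. 1 - f x)"
  have "e \<in> D"
    unfolding e_def
  proof (rule D_I[OF assms(5)])
    show "continuous_map X euclideanreal (\<lambda>x. 1 - f x)" using cf by (intro continuous_map_diff) auto
    show "bounded ((\<lambda>x. 1 - f x) ` topspace X)"
      by (rule bounded_subset[of "{0..1}"]) (use range in auto)
  qed
  moreover have "e x = 1" using f(2) assms by (auto simp: e_def)
  moreover have "e z = 0" if "z \<in> F - {x}" for z using f(3) assms that by (auto simp: e_def image_subset_iff)
  ultimately show ?thesis by blast
qed

text \<open>Continuity at the zero function gives a basic neighbourhood, which restricts only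
  finitely many coordinates; these form \<open>F\<close>.\<close>

lemma finite_zero_neighbourhood:
  fixes L :: "('a \<Rightarrow> real) \<Rightarrow> real"
  assumes D: "D \<in> {C_fun X, C_bounded_fun X}"
    and cont: "continuous_map (pointwise_topology X D) euclideanreal L"
    and z0: "L (\<lambda>x\<in>topspace X. 0) = 0"
  obtains F where "finite F" "F \<subseteq> topspace X"
    "\<And>f. f \<in> D \<Longrightarrow> (\<And>x. x \<in> F \<Longrightarrow> f x = 0) \<Longrightarrow> \<bar>L f\<bar> < 1"
proof -
  let ?P = "product_topology (\<lambda>_. euclideanreal) (topspace X)"
  let ?z = "\<lambda>x\<in>topspace X. 0::real"
  have topD: "topspace (pointwise_topology X D) = D"
    using D_extensional[OF D] by (auto simp: pointwise_topology_def topspace_product_topology PiE_def)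
  have zD: "?z \<in> D" by (rule D_I[OF D]) (auto simp: image_constant_conv)
  have "openin (pointwise_topology X D) {f \<in> topspace (pointwise_topology X D). L f \<in> {-1<..<1}}"
    by (rule openin_continuous_map_preimage[OF cont]) simp
  then obtain W where W: "openin ?P W" "{f \<in> D. L f \<in> {-1<..<1}} = W \<inter> D"
    unfolding topD unfolding pointwise_topology_def openin_subtopology by blast
  have "?z \<in> {f \<in> D. L f \<in> {-1<..<1}}" using zD z0 by simp
  then have "?z \<in> W" unfolding W(2) by (rule IntD1)
  then obtain U where U: "finite {x \<in> topspace X. U x \<noteq> UNIV}" "?z \<in> PiE (topspace X) U"
      "PiE (topspace X) U \<subseteq> W"
    using W(1) unfolding openin_product_topology_alt topspace_euclidean by meson
  show ?thesis
  proof (rule that[of "{x \<in> topspace X. U x \<noteq> UNIV}"])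
    fix f assume f: "f \<in> D" "\<And>x. x \<in> {x \<in> topspace X. U x \<noteq> UNIV} \<Longrightarrow> f x = 0"
    have "f x \<in> U x" if "x \<in> topspace X" for x
    proof (cases "U x = UNIV")
      case False
      then have "f x = 0" using f(2) that by blast
      moreover have "?z x \<in> U x" using U(2) that by (rule PiE_mem)
      ultimately show ?thesis using that by simp
    qed simp
    then have "f \<in> PiE (topspace X) U" using D_extensional[OF D f(1)] by (auto simp: PiE_def)
    then have "f \<in> {f \<in> D. L f \<in> {-1<..<1}}" unfolding W(2) using U(3) f(1) by blast
    then show "\<bar>L f\<bar> < 1" by (simp add: abs_less_iff)
  qed (use U in auto)
qed

text \<open>By homogeneity, \<open>|L f| < 1\<close> for all \<open>f\<close> vanishing on
  \<open>F\<close> forces \<open>L f = 0\<close> for them. Subtracting multiples of bump functions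
  at the points of \<open>F\<close> brings any \<open>f\<close> into this case, so
  \<open>L f\<close> is determined by the values on \<open>F\<close> with coefficients
  \<open>L (e x)\<close>.\<close>

lemma finite_support:
  fixes L :: "('a \<Rightarrow> real) \<Rightarrow> real"
  assumes X: "tychonoff_space X" and D: "D \<in> {C_fun X, C_bounded_fun X}"
    and cont: "continuous_map (pointwise_topology X D) euclideanreal L"
    and add: "\<And>f g. f \<in> D \<Longrightarrow> g \<in> D \<Longrightarrow> L (\<lambda>x\<in>topspace X. f x + g x) = L f + L g"
    and scale: "\<And>c f. f \<in> D \<Longrightarrow> L (\<lambda>x\<in>topspace X. c * f x) = c * L f"
  obtains F c where "finite F" "F \<subseteq> topspace X" "\<And>f. f \<in> D \<Longrightarrow> L f = (\<Sum>x\<in>F. c x * f x)"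
proof -
  have zD: "(\<lambda>x\<in>topspace X. 0) \<in> D" by (rule D_I[OF D]) (auto simp: image_constant_conv)
  have z0: "L (\<lambda>x\<in>topspace X. 0) = 0"
    using scale[OF zD, of 0] by simp
  obtain F where F: "finite F" "F \<subseteq> topspace X"
      and small: "\<And>f. f \<in> D \<Longrightarrow> (\<And>x. x \<in> F \<Longrightarrow> f x = 0) \<Longrightarrow> \<bar>L f\<bar> < 1"
    using finite_zero_neighbourhood[OF D cont z0] by blast
  have vanish: "L f = 0" if f: "f \<in> D" "\<And>x. x \<in> F \<Longrightarrow> f x = 0" for f
  proof (rule ccontr)
    assume "L f \<noteq> 0"
    \<comment> \<open>On the rescaled function \<open>L\<close> would take the value 1.\<close>
    moreover have "\<bar>L (\<lambda>x\<in>topspace X. inverse (L f) * f x)\<bar> < 1"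
      by (rule small[OF D_scale[OF D f(1) f(1)]]) (use f F in auto)
    ultimately show False using scale[OF f(1)] by simp
  qed
  have "\<forall>x\<in>F. \<exists>e. e \<in> D \<and> e x = 1 \<and> (\<forall>z\<in>F - {x}. e z = 0)"
    using tychonoff_bump[OF X F _ D] by blast
  from bchoice[OF this] obtain e where e: "\<And>x. x \<in> F \<Longrightarrow> e x \<in> D" "\<And>x. x \<in> F \<Longrightarrow> e x x = 1"
      "\<And>x z. x \<in> F \<Longrightarrow> z \<in> F \<Longrightarrow> z \<noteq> x \<Longrightarrow> e x z = 0" by blast
  have main: "L f = (\<Sum>x\<in>F. L (e x) * f x)" if f: "f \<in> D" for f
  proof -
    \<comment> \<open>\<open>g S\<close> is \<open>f\<close> with its values at the points of
      \<open>S\<close> cancelled by bumps; the induction on \<open>S\<close> uses binary additivity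
      of \<open>L\<close>.\<close>
    define g where "g S = (\<lambda>x\<in>topspace X. f x + (\<Sum>s\<in>S. - f s * e s x))" for S
    have g: "g S \<in> D \<and> L (g S) = L f + (\<Sum>s\<in>S. - f s * L (e s))" if "S \<subseteq> F" for S
      using finite_subset[OF that F(1)] that
    proof (induction S rule: finite_induct)
      case empty
      have "g {} = f" using D_extensional[OF D f] by (auto simp: g_def extensional_restrict)
      then show ?case using f by simp
    next
      case (insert s S)
      define k where "k = (\<lambda>x\<in>topspace X. - f s * e s x)"
      have es: "e s \<in> D" using e insert.prems by auto
      have k: "k \<in> D" "L k = - f s * L (e s)"
        unfolding k_def by (rule D_scale[OF D es es], rule scale[OF es])
      have gS: "g S \<in> D" "L (g S) = L f + (\<Sum>s\<in>S. - f s * L (e s))"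
        using insert by auto
      have eq: "g (insert s S) = (\<lambda>x\<in>topspace X. g S x + k x)"
        using insert.hyps by (auto simp: g_def k_def restrict_def fun_eq_iff)
      have "g (insert s S) \<in> D" unfolding eq by (rule D_add[OF D gS(1) k(1)])
      moreover have "L (g (insert s S)) = L (g S) + L k" unfolding eq by (rule add[OF gS(1) k(1)])
      ultimately show ?case using gS(2) k(2) insert.hyps by simp
    qed
    have "L (g F) = 0"
    proof (rule vanish)
      show "g F \<in> D" using g by blast
      fix x assume x: "x \<in> F"
      have "(\<Sum>s\<in>F. - f s * e s x) = (\<Sum>s\<in>F. if s = x then - f x else 0)"
        using e x by (intro sum.cong) auto
      also have "\<dots> = - f x" using x F by simp
      finally show "g F x = 0" using x F by (auto simp: g_def)
    qed
    then show ?thesis using g[of F] by (simp add: sum_negf mult.commute)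
  qed
  show ?thesis using that[OF F, of "\<lambda>x. L (e x)"] main by blast
qed

subsection \<open>A countable system of functions\<close>

text \<open>\<open>YMul\<close> and \<open>XMul\<close> stand for the products taken in \<open>D(Y)\<close> and in \<open>D(X)\<close>.\<close>

datatype tm = Base | Unit | YMul tm tm | XMul tm tm | Level tm rat rat

instance tm :: countable by countable_datatype

locale zero_dim_surjection =
  fixes X :: "'a topology" and Y :: "'b topology" and DX DY
    and T :: "('a \<Rightarrow> real) \<Rightarrow> ('b \<Rightarrow> real)" and h :: "'b \<Rightarrow> real"
  assumes X: "tychonoff_space X"
    and DX: "DX \<in> {C_fun X, C_bounded_fun X}" and DY: "DY \<in> {C_fun Y, C_bounded_fun Y}"
    and T_cont: "continuous_map (pointwise_topology X DX) (pointwise_topology Y DY) T"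
    and T_lin: "linear_on_fun_space X Y DX T"
    and T_surj: "T ` DX = DY"
    and dim: "covering_dim_le X 0"
    and h_cont: "continuous_map Y euclideanreal h"
    and h_bounded: "bounded (h ` topspace Y)"
begin

definition level_set :: "('a \<Rightarrow> real) \<Rightarrow> rat \<Rightarrow> rat \<Rightarrow> 'a set" where
  "level_set f q d = (SOME U. openin X U \<and> closedin X U \<and> (0 < d \<longrightarrow> (\<forall>x\<in>topspace X.
     (\<bar>f x - of_rat q\<bar> \<le> of_rat d \<longrightarrow> x \<in> U) \<and> (x \<in> U \<longrightarrow> \<bar>f x - of_rat q\<bar> < 2 * of_rat d))))"

text \<open>Preimages under \<open>T\<close> are chosen arbitrarily, as only their images are
  prescribed. Nesting of constructors closes the family under all operations at once, in particular
  under taking \<open>Level\<close> of a chosen preimage.\<close>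

primrec val :: "tm \<Rightarrow> 'a \<Rightarrow> real" where
  "val Base = inv_into DX T (restrict h (topspace Y))"
| "val Unit = inv_into DX T (\<lambda>y\<in>topspace Y. 1)"
| "val (YMul s t) = inv_into DX T (\<lambda>y\<in>topspace Y. T (val s) y * T (val t) y)"
| "val (XMul s t) = (\<lambda>x\<in>topspace X. val s x * val t x)"
| "val (Level t q d) = (\<lambda>x\<in>topspace X. indicator (level_set (val t) q d) x)"

lemma level_set:
  assumes f: "continuous_map X euclideanreal f"
  shows "openin X (level_set f q d)" "closedin X (level_set f q d)"
    and "0 < d \<Longrightarrow> x \<in> topspace X \<Longrightarrow> \<bar>f x - of_rat q\<bar> \<le> of_rat d \<Longrightarrow> x \<in> level_set f q d"
    and "0 < d \<Longrightarrow> x \<in> level_set f q d \<Longrightarrow> \<bar>f x - of_rat q\<bar> < 2 * of_rat d"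
proof -
  have "\<exists>U. openin X U \<and> closedin X U \<and> (0 < d \<longrightarrow> (\<forall>x\<in>topspace X.
     (\<bar>f x - of_rat q\<bar> \<le> of_rat d \<longrightarrow> x \<in> U) \<and> (x \<in> U \<longrightarrow> \<bar>f x - of_rat q\<bar> < 2 * of_rat d)))"
  proof (cases "0 < d")
    case True
    then have d: "(of_rat d :: real) < 2 * of_rat d" by simp
    have "continuous_map X euclideanreal (\<lambda>x. \<bar>f x - of_rat q\<bar>)"
      using f by (intro continuous_map_real_abs continuous_map_diff) auto
    from covering_dim_0_clopen[OF dim this d] show ?thesis by metis
  next
    case False
    then show ?thesis by (intro exI[of _ "{}"]) simp
  qed
  from someI_ex[OF this] have *: "openin X (level_set f q d)" "closedin X (level_set f q d)"
      "0 < d \<Longrightarrow> \<forall>x\<in>topspace X. (\<bar>f x - of_rat q\<bar> \<le> of_rat d \<longrightarrow> x \<in> level_set f q d)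
        \<and> (x \<in> level_set f q d \<longrightarrow> \<bar>f x - of_rat q\<bar> < 2 * of_rat d)"
    unfolding level_set_def by blast+
  then show "openin X (level_set f q d)" "closedin X (level_set f q d)" by blast+
  show "x \<in> level_set f q d" if "0 < d" "x \<in> topspace X" "\<bar>f x - of_rat q\<bar> \<le> of_rat d"
    using *(3) that by blast
  show "\<bar>f x - of_rat q\<bar> < 2 * of_rat d" if "0 < d" "x \<in> level_set f q d"
    using *(3) that openin_subset[OF *(1)] by blast
qed

lemma T_in_DY: "f \<in> DX \<Longrightarrow> T f \<in> DY"
  using T_surj by blast

lemma preimage:
  assumes "g \<in> DY"
  shows "inv_into DX T g \<in> DX" "T (inv_into DX T g) = g"
  using assms unfolding T_surj[symmetric] by (rule inv_into_into, rule f_inv_into_f)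

lemma val_in_DX: "val t \<in> DX"
proof (induction t)
  case Base
  then show ?case using preimage D_I[OF DY h_cont h_bounded] by simp
next
  case Unit
  have "(\<lambda>y\<in>topspace Y. 1) \<in> DY" by (rule D_I[OF DY]) (auto simp: image_constant_conv)
  then show ?case using preimage by simp
next
  case (YMul s t)
  then have "(\<lambda>y\<in>topspace Y. T (val s) y * T (val t) y) \<in> DY"
    by (intro D_mult[OF DY] T_in_DY)
  then show ?case using preimage by simp
next
  case (XMul s t)
  then have "(\<lambda>x\<in>topspace X. val s x * val t x) \<in> DX" by (intro D_mult[OF DX])
  then show ?case by (simp only: val.simps)
next
  case (Level t q d)
  let ?U = "level_set (val t) q d"
  have "openin X ?U" "closedin X ?U" using level_set D_continuous[OF DX Level] by auto
  moreover have "bounded ((indicator ?U :: 'a \<Rightarrow> real) ` topspace X)"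
    by (rule bounded_subset[of "{0..1}"]) (auto simp: indicator_def)
  ultimately have "restrict (indicator ?U) (topspace X) \<in> DX"
    by (intro D_I[OF DX] continuous_map_indicator)
  then show ?case by (simp only: val.simps)
qed

lemma val_cont: "continuous_map X euclideanreal (val t)"
  using D_continuous[OF DX val_in_DX] .

lemma T_val:
  assumes y: "y \<in> topspace Y"
  shows "T (val Base) y = h y" "T (val Unit) y = 1" "T (val (YMul s t)) y = T (val s) y * T (val t) y"
proof -
  have "restrict h (topspace Y) \<in> DY" by (rule D_I[OF DY h_cont h_bounded])
  then show "T (val Base) y = h y" using y by (simp add: preimage)
  have "(\<lambda>y\<in>topspace Y. 1) \<in> DY" by (rule D_I[OF DY]) (auto simp: image_constant_conv)
  then show "T (val Unit) y = 1" using y by (simp add: preimage)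
  have "(\<lambda>y\<in>topspace Y. T (val s) y * T (val t) y) \<in> DY"
    by (intro D_mult[OF DY] T_in_DY val_in_DX)
  then show "T (val (YMul s t)) y = T (val s) y * T (val t) y" using y by (simp add: preimage)
qed

definition points :: "(tm \<Rightarrow> real) set" where
  "points = (\<lambda>x t. val t x) ` topspace X"

sublocale character_pair points XMul YMul Unit
proof
  fix p s t assume "p \<in> points"
  then show "p (XMul s t) = p s * p t" by (auto simp: points_def)
next
  fix e r :: real and t assume e: "0 < e"
  \<comment> \<open>Levels carry rational parameters to keep the terms countable, so the real
    \<open>r\<close> is approximated by \<open>q\<close> within \<open>d\<close>. Points with value
    \<open>r\<close> are then within \<open>d\<close> of \<open>q\<close>, and points of the level
    set are within \<open>2 * d\<close> of \<open>q\<close>, hence within \<open>3 * d < e\<close>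
    of \<open>r\<close>.\<close>
  obtain d where d: "0 < d" "of_rat d < e / 3" using of_rat_dense[of 0 "e / 3"] e by auto
  obtain q where q: "r - of_rat d < of_rat q" "of_rat q < r"
    using of_rat_dense[of "r - of_rat d" r] d(1) by auto
  have lev: "val (Level t q d) x = indicator (level_set (val t) q d) x" if "x \<in> topspace X" for x
    using that by simp
  have 1: "val (Level t q d) x = 0 \<or> val (Level t q d) x = 1" if "x \<in> topspace X" for x
    unfolding lev[OF that] by (simp add: indicator_def)
  have 2: "val (Level t q d) x = 1" if "x \<in> topspace X" "val t x = r" for x
    unfolding lev[OF that(1)] using level_set(3)[OF val_cont d(1) that(1), of t q] q that(2) by simp
  have 3: "\<bar>val t x - r\<bar> < e" if "x \<in> topspace X" "val (Level t q d) x = 1" for x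
  proof -
    have "x \<in> level_set (val t) q d" using that(2) unfolding lev[OF that(1)] by (simp add: indicator_def split: if_splits)
    from level_set(4)[OF val_cont d(1) this] have "\<bar>val t x - of_rat q\<bar> < 2 * of_rat d" .
    then show ?thesis using q d(2) by linarith
  qed
  show "\<exists>c. (\<forall>x\<in>points. x c = 0 \<or> x c = 1) \<and> (\<forall>x\<in>points. x t = r \<longrightarrow> x c = 1)
      \<and> (\<forall>x\<in>points. x c = 1 \<longrightarrow> \<bar>x t - r\<bar> < e)"
    by (rule exI[of _ "Level t q d"]) (use 1 2 3 in \<open>simp add: points_def del: val.simps\<close>)
qed

definition embed :: "'b \<Rightarrow> tm \<Rightarrow> real" where
  "embed y t = T (val t) y"

text \<open>Evaluation at \<open>y\<close> after \<open>T\<close> is a continuous linear functional,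
  hence a finite combination of point evaluations, which puts \<open>embed y\<close> in the span.
  The terms \<open>Unit\<close> and \<open>YMul\<close> give the multiplicative conditions.\<close>

lemma embed_in_Z:
  assumes y: "y \<in> topspace Y"
  shows "embed y \<in> Z"
proof -
  have "continuous_map (pointwise_topology Y DY) euclideanreal (\<lambda>g. g y)"
    unfolding pointwise_topology_def
    by (intro continuous_map_from_subtopology continuous_map_product_projection y)
  then have "continuous_map (pointwise_topology X DX) euclideanreal ((\<lambda>g. g y) \<circ> T)"
    by (rule continuous_map_compose[OF T_cont])
  then have cont: "continuous_map (pointwise_topology X DX) euclideanreal (\<lambda>f. T f y)"
    by (simp add: o_def)
  obtain F c where F: "finite F" "F \<subseteq> topspace X" "\<And>f. f \<in> DX \<Longrightarrow> T f y = (\<Sum>x\<in>F. c x * f x)"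
  proof (rule finite_support[OF X DX cont])
    show "T (\<lambda>x\<in>topspace X. f x + g x) y = T f y + T g y" if "f \<in> DX" "g \<in> DX" for f g
      using T_lin that y by (simp add: linear_on_fun_space_def)
    show "T (\<lambda>x\<in>topspace X. c * f x) y = c * T f y" if "f \<in> DX" for c f
      using T_lin that y by (simp add: linear_on_fun_space_def)
  qed blast
  have "embed y = (\<Sum>x\<in>F. (\<lambda>t. c x * val t x))"
    by (rule ext) (simp add: embed_def sum_fun_apply F(3)[OF val_in_DX])
  also have "\<dots> \<in> fun_space.span points"
  proof (rule fun_space.span_sum)
    fix x assume "x \<in> F"
    then have "(\<lambda>t. val t x) \<in> points" using F(2) by (auto simp: points_def)
    then show "(\<lambda>t. c x * val t x) \<in> fun_space.span points"
      using fun_space.span_scale[OF fun_space.span_base] by blast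
  qed
  finally show ?thesis using T_val[OF y] by (simp add: Z_def embed_def del: val.simps)
qed

lemma continuous_embed: "continuous_map Y (top_of_set Z) embed"
proof -
  have "continuous_map Y euclideanreal (\<lambda>y. embed y t)" for t
    unfolding embed_def using D_continuous[OF DY T_in_DY[OF val_in_DX]] .
  then have "continuous_map Y euclidean embed"
    by (simp add: euclidean_product_topology[symmetric] continuous_map_componentwise_UNIV)
  then show ?thesis using embed_in_Z by (auto simp: continuous_map_in_subtopology)
qed

text \<open>The coordinate \<open>Base\<close> of \<open>embed y\<close> is \<open>h y\<close>, so
  both level conditions are pulled back from disjoint closed subsets of \<open>Z\<close>, and so is
  the clopen set between them.\<close>

lemma clopen_level_separation:
  "\<exists>C. openin Y C \<and> closedin Y C \<and> (\<forall>y\<in>topspace Y. (h y \<le> 0 \<longrightarrow> y \<in> C) \<and> (h y \<ge> 1 \<longrightarrow> y \<notin> C))"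
proof -
  have cont: "continuous_on UNIV (\<lambda>p :: tm \<Rightarrow> real. p Base)" by simp
  have "closed {p :: tm \<Rightarrow> real. p Base \<le> 0}" "closed {p :: tm \<Rightarrow> real. 1 \<le> p Base}"
    by (intro closed_Collect_le continuous_on_const cont)+
  then have "closedin (top_of_set Z) (Z \<inter> {p. p Base \<le> 0})" "closedin (top_of_set Z) (Z \<inter> {p. 1 \<le> p Base})"
    by (auto simp: closedin_closed_Int)
  moreover have "disjnt (Z \<inter> {p. p Base \<le> 0}) (Z \<inter> {p. 1 \<le> p Base})" by (auto simp: disjnt_def)
  ultimately obtain C where C: "openin (top_of_set Z) C" "closedin (top_of_set Z) C"
      "Z \<inter> {p. p Base \<le> 0} \<subseteq> C" "disjnt (Z \<inter> {p. 1 \<le> p Base}) C"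
    by (rule clopen_separation)
  have base: "embed y Base = h y" if "y \<in> topspace Y" for y
    unfolding embed_def using T_val(1)[OF that] .
  let ?C = "{y \<in> topspace Y. embed y \<in> C}"
  have "openin Y ?C" "closedin Y ?C"
    using openin_continuous_map_preimage[OF continuous_embed C(1)]
      closedin_continuous_map_preimage[OF continuous_embed C(2)] by auto
  moreover have "\<forall>y\<in>topspace Y. (h y \<le> 0 \<longrightarrow> y \<in> ?C) \<and> (h y \<ge> 1 \<longrightarrow> y \<notin> ?C)"
  proof (intro ballI conjI impI)
    fix y assume y: "y \<in> topspace Y" "h y \<le> 0"
    then have "embed y \<in> Z \<inter> {p. p Base \<le> 0}" using embed_in_Z base by simp
    then show "y \<in> ?C" using C(3) y by blast
  next
    fix y assume y: "y \<in> topspace Y" "1 \<le> h y"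
    then have "embed y \<in> Z \<inter> {p. 1 \<le> p Base}" using embed_in_Z base by simp
    then show "y \<notin> ?C" using C(4) unfolding disjnt_iff by blast
  qed
  ultimately show ?thesis by blast
qed

end

theorem theorem1p3:
  fixes X :: "'a topology" and Y :: "'b topology"
    and DX :: "('a \<Rightarrow> real) set" and DY :: "('b \<Rightarrow> real) set"
    and T :: "('a \<Rightarrow> real) \<Rightarrow> ('b \<Rightarrow> real)"
  assumes "tychonoff_space X" and "tychonoff_space Y"
    and "DX \<in> {C_fun X, C_bounded_fun X}" and "DY \<in> {C_fun Y, C_bounded_fun Y}"
    and "continuous_map (pointwise_topology X DX) (pointwise_topology Y DY) T"
    and "linear_on_fun_space X Y DX T"
    and "T ` DX = DY"
    and "covering_dim X = 0"
  shows "covering_dim Y = 0"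
proof -
  have "covering_dim_le X 0" using assms(8) by (simp add: covering_dim_eq_0_iff)
  have "covering_dim_le Y 0"
  proof (rule covering_dim_le_0I)
    fix h assume h: "continuous_map Y euclideanreal h" "\<And>y. y \<in> topspace Y \<Longrightarrow> 0 \<le> h y \<and> h y \<le> 1"
    \<comment> \<open>Boundedness places the restriction of \<open>h\<close> in \<open>DY\<close>
      for both choices of \<open>DY\<close>.\<close>
    have "bounded (h ` topspace Y)"
      by (rule bounded_subset[of "{0..1}"]) (use h(2) in auto)
    then interpret zero_dim_surjection X Y DX DY T h
      using assms(1,3-7) h(1) \<open>covering_dim_le X 0\<close> by unfold_locales
    show "\<exists>C. openin Y C \<and> closedin Y C \<and>
        (\<forall>y\<in>topspace Y. (h y \<le> 0 \<longrightarrow> y \<in> C) \<and> (1 \<le> h y \<longrightarrow> y \<notin> C))"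
      by (rule clopen_level_separation)
  qed
  then show ?thesis by (simp add: covering_dim_eq_0_iff)
qed

end
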